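(* Let $\lambda^{*}=(\sqrt{2}+1)e^{\sqrt{2}}$, $1<\lambda<\lambda^{*}$ and $\zeta_\lambda(z)=\lambda\frac{z}{z+1}e^{-z}$. Let $a_\lambda$ be the unique nonzero real fixed point of $\zeta_\lambda$ (it lies in $(0,\sqrt2)$ and is attracting), and let $A(a_\lambda)=\{z\in\mathbb{C}:\zeta_\lambda^{n}(z)\to a_\lambda \text{ as } n\to\infty\}$ be its basin of attraction. Then $J(\zeta_\lambda)=\hat{\mathbb{C}}\setminus A(a_\lambda)$.
   Context: $\hat{\mathbb{C}}$ is the extended complex plane. For the transcendental meromorphic function $\zeta_\lambda$, the Fatou set is the set of points of $\hat{\mathbb{C}}$ having a neighbourhood on which all iterates $\zeta_\lambda^{n}$ are defined and form a normal family; the Julia set $J(\zeta_\lambda)$ is its complement. *)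

theory Defs
  imports "HOL-Analysis.Analysis"
begin

text \<open>The extended complex plane: None represents the point at infinity.\<close>
type_synonym ecomplex = "complex option"

fun chordal :: "ecomplex \<Rightarrow> ecomplex \<Rightarrow> real" where
  "chordal (Some a) (Some b) = 2 * cmod (a - b) / (sqrt (1 + (cmod a)\<^sup>2) * sqrt (1 + (cmod b)\<^sup>2))"
| "chordal (Some a) None = 2 / sqrt (1 + (cmod a)\<^sup>2)"
| "chordal None (Some b) = 2 / sqrt (1 + (cmod b)\<^sup>2)"
| "chordal None None = 0"

definition sball :: "ecomplex \<Rightarrow> real \<Rightarrow> ecomplex set" where
  "sball z r = {w. chordal z w < r}"

definition zeta :: "real \<Rightarrow> complex \<Rightarrow> complex" where
  "zeta lam z = complex_of_real lam * z / (z + 1) * exp (- z)"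

text \<open>zeta as a partial map of the extended plane: outer None = undefined.
  It has a pole at -1 (value infinity) and is undefined at infinity
  (essential singularity).\<close>
fun zeta_ext :: "real \<Rightarrow> ecomplex \<Rightarrow> ecomplex option" where
  "zeta_ext lam None = None"
| "zeta_ext lam (Some z) = Some (if z = -1 then None else Some (zeta lam z))"

fun zeta_iter :: "real \<Rightarrow> nat \<Rightarrow> ecomplex \<Rightarrow> ecomplex option" where
  "zeta_iter lam 0 w = Some w"
| "zeta_iter lam (Suc n) w = (case zeta_iter lam n w of None \<Rightarrow> None | Some v \<Rightarrow> zeta_ext lam v)"

definition normal_family_on :: "(nat \<Rightarrow> ecomplex \<Rightarrow> ecomplex) \<Rightarrow> ecomplex set \<Rightarrow> bool" where
  "normal_family_on F V \<longleftrightarrow>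
     (\<forall>s :: nat \<Rightarrow> nat. \<exists>r :: nat \<Rightarrow> nat. \<exists>g :: ecomplex \<Rightarrow> ecomplex. strict_mono r \<and>
        (\<forall>w\<in>V. \<exists>\<delta>>0. sball w \<delta> \<subseteq> V \<and>
           (\<forall>e>0. \<forall>\<^sub>F j in sequentially. \<forall>u\<in>sball w \<delta>. chordal (F (s (r j)) u) (g u) < e)))"

definition fatou_set :: "real \<Rightarrow> ecomplex set" where
  "fatou_set lam = {z. \<exists>\<epsilon>>0.
      (\<forall>n. \<forall>w\<in>sball z \<epsilon>. zeta_iter lam n w \<noteq> None) \<and>
      normal_family_on (\<lambda>n w. the (zeta_iter lam n w)) (sball z \<epsilon>)}"

definition julia_set :: "real \<Rightarrow> ecomplex set" where
  "julia_set lam = UNIV - fatou_set lam"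

definition basin :: "real \<Rightarrow> complex \<Rightarrow> complex set" where
  "basin lam a = {z. \<exists>x :: nat \<Rightarrow> complex.
      (\<forall>n. zeta_iter lam n (Some z) = Some (Some (x n))) \<and> x \<longlonglongrightarrow> a}"

end

theory Submission
  imports Defs "HOL-Complex_Analysis.Complex_Analysis"
begin

text \<open>
  Write $f = \zeta_\lambda$. Both critical values of $f$ are positive, its finite asymptotic value is $0$,
  and every positive real is attracted to $a$: with $\varphi(x) = x + \ln(1 + x)$ the quantity
  $|\varphi(x) - \varphi(a)|$ decreases along orbits. So outside the basin all the dynamics takes
  place in the slit plane $W = \mathbb{C} \setminus [0,\infty)$, on which the branches of $f^{-1}$
  are defined; hence $f$ expands the hyperbolic metric of $W$. Here the expansion is verified by
  an elementary trigonometric estimate.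

  If all iterates are defined on a disc disjoint from the basin, then they map it into $W$, and the
  Schwarz lemma bounds the hyperbolic derivatives of all $f^n$ at its centre. The expansion factors along
  the orbit of the centre therefore tend to $1$. As the factors are large near the pole and near infinity in
  the directions $\mathrm{Re}\, z \le |z|/2$, and $0$ is repelling, the orbit accumulates at a finite point other
  than $0$ and $-1$. By continuity the factor there is $1$, contradicting strict expansion. So the basin is
  dense in every disc on which the iterates are defined, and normality gives convergence to $a$ at the centre.
\<close>

section \<open>Expansion of the hyperbolic metric of the slit plane\<close>

text \<open>The negative of the elasticity $z f'(z) / f(z)$, which does not depend on $\lambda$.\<close>
definition zeta_elast :: "'a::real_normed_field \<Rightarrow> 'a" where
  "zeta_elast z = z - 1 / (z + 1)"

text \<open>Equal to $|\sin(\mathrm{Arg}(w)/2)|$, so that $1 / (2 |w| \cdot \mathrm{half\_sine}(w))$ is the hyperbolic density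
  of the slit plane.\<close>
definition half_sine :: "complex \<Rightarrow> real" where
  "half_sine w = sqrt ((1 - Re w / cmod w) / 2)"

lemma half_sine_rcis:
  assumes "R > 0"
  shows "half_sine (rcis R t) = \<bar>sin (t / 2)\<bar>"
proof -
  have "cos t = 1 - 2 * (sin (t / 2))\<^sup>2"
    using cos_double_sin[of "t / 2"] by simp
  then show ?thesis
    using assms by (simp add: half_sine_def)
qed

lemma half_sine_bounds: "0 \<le> half_sine w" "half_sine w \<le> 1"
proof -
  have "\<bar>Re w / cmod w\<bar> \<le> 1"
    using abs_Re_le_cmod[of w] by (cases "w = 0") (auto simp: divide_simps)
  then have "- 1 \<le> Re w / cmod w" "Re w / cmod w \<le> 1"
    unfolding abs_le_iff by linarith+
  then show "0 \<le> half_sine w" "half_sine w \<le> 1"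
    unfolding half_sine_def by auto
qed

text \<open>On the slit plane the argument is never 0, so the hyperbolic density built from
  \<open>half_sine\<close> is finite there.\<close>

lemma half_sine_pos:
  assumes "w \<notin> \<real>\<^sub>\<ge>\<^sub>0"
  shows "half_sine w > 0"
proof -
  have "Re w \<noteq> cmod w"
  proof
    assume eq: "Re w = cmod w"
    then have "Re w \<ge> 0" by simp
    moreover have "Im w = 0" using cmod_power2[of w] eq by simp
    ultimately show False using assms by (simp add: complex_nonneg_Reals_iff)
  qed
  then have "Re w < cmod w" using complex_Re_le_cmod[of w] by simp
  moreover have "w \<noteq> 0" using assms by auto
  ultimately show ?thesis by (simp add: half_sine_def)
qed

lemma half_sine_ge_half:
  assumes "Re w \<le> cmod w / 2" "w \<noteq> 0"
  shows "half_sine w \<ge> 1 / 2"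
proof -
  have "Re w / cmod w \<le> 1 / 2" using assms by (simp add: field_simps)
  then have "(1 / 2)\<^sup>2 \<le> (1 - Re w / cmod w) / 2" by (simp add: power2_eq_square)
  then show ?thesis unfolding half_sine_def by (rule real_le_rsqrt)
qed

lemma isCont_half_sine: "w \<noteq> 0 \<Longrightarrow> isCont half_sine w"
  unfolding half_sine_def by (intro continuous_intros) auto

lemma mult_cos_le_sin:
  fixes t :: real
  assumes "0 \<le> t" "t \<le> pi"
  shows "t * cos t \<le> sin t"
proof -
  have "(\<lambda>t. sin t - t * cos t) 0 \<le> (\<lambda>t. sin t - t * cos t) t"
  proof (rule DERIV_nonneg_imp_nondecreasing[OF assms(1)])
    fix x assume "0 \<le> x" "x \<le> t"
    then show "\<exists>y. ((\<lambda>t. sin t - t * cos t) has_real_derivative y) (at x) \<and> 0 \<le> y"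
      using assms by (intro exI[of _ "x * sin x"] conjI)
        (auto intro!: derivative_eq_intros mult_nonneg_nonneg sin_ge_zero)
  qed
  then show ?thesis by simp
qed

text \<open>\<open>\<beta>\<close> is the angle under which the segment from -1 to 0 is seen from
  \<open>z\<close>, and \<open>\<beta> - y\<close> is an argument of \<open>zeta lam z\<close>. The
  claim becomes \<open>\<bar>sin ((\<beta> - y) / 2)\<bar> < q * s\<close>, from which
  \<open>lam\<close> has disappeared. Rough bounds for \<open>q\<close> and \<open>s\<close> suffice
  when \<open>x \<le> 0\<close>; the right half-plane needs finer ones.\<close>

lemma half_sine_zeta_less_upper:
  fixes z :: complex
  assumes lam: "lam > 0" and Im: "Im z > 0"
  shows "half_sine (zeta lam z) < cmod (zeta_elast z) * half_sine z"
proof -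
  define x y r m \<beta> p where "x = Re z" and "y = Im z" and "r = cmod z" and "m = cmod (z + 1)"
    and "\<beta> = Arg (z / (z + 1))" and "p = r * m"
  define s where "s = half_sine z"
  define q where "q = cmod (zeta_elast z)"
  have y: "y > 0" using Im by (simp add: y_def)
  have z: "z = Complex x y" by (simp add: x_def y_def)
  have nz: "z \<noteq> 0" "z + 1 \<noteq> 0"
    using Im by (auto simp: complex_eq_iff)
  have r: "r > 0" and m: "m > 0" using nz by (auto simp: r_def m_def)
  have p: "p > 0" using r m by (simp add: p_def)
  have r2: "r\<^sup>2 = x\<^sup>2 + y\<^sup>2" and m2: "m\<^sup>2 = (x + 1)\<^sup>2 + y\<^sup>2"
    by (simp_all add: r_def m_def z cmod_power2)
  have w: "z / (z + 1) = rcis (r / m) \<beta>"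
    by (simp add: \<beta>_def r_def m_def flip: norm_divide)
      (simp add: rcis_cmod_Arg)
  have w_eq: "z / (z + 1) = Complex ((r\<^sup>2 + x) / m\<^sup>2) (y / m\<^sup>2)"
    unfolding r2 m2 by (simp add: z complex_eq_iff Re_divide Im_divide power2_eq_square algebra_simps)
  have "Im (z / (z + 1)) > 0"
    unfolding w_eq using y m by simp
  then have \<beta>: "0 < \<beta>" "\<beta> < pi"
    using Arg_lt_pi[of "z / (z + 1)"] unfolding \<beta>_def by auto
  have sin\<beta>: "p * sin \<beta> = y" and cos\<beta>: "p * cos \<beta> = r\<^sup>2 + x"
    using w w_eq r m unfolding p_def
    by (auto simp: complex_eq_iff field_simps power2_eq_square)
  have zeta: "zeta lam z = rcis (lam * (r / m) * exp (- x)) (\<beta> - y)"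
  proof -
    have "exp (- z) = rcis (exp (- x)) (- y)"
      by (simp add: z exp_eq_polar rcis_def complex_eq_iff)
    then have "zeta lam z = rcis lam 0 * rcis (r / m) \<beta> * rcis (exp (- x)) (- y)"
      by (simp add: zeta_def w flip: times_divide_eq_right)
    then show ?thesis unfolding rcis_mult by simp
  qed
  have S: "half_sine (zeta lam z) = \<bar>sin ((\<beta> - y) / 2)\<bar>"
    unfolding zeta using lam r m by (intro half_sine_rcis) simp
  have s0: "s \<ge> 0" by (simp add: s_def half_sine_bounds)
  have s2: "s\<^sup>2 = (1 - x / r) / 2"
  proof -
    have "x / r \<le> 1" using r complex_Re_le_cmod[of z] by (simp add: x_def r_def)
    then show ?thesis unfolding s_def half_sine_def by (simp add: x_def r_def)
  qed
  have Qeq: "zeta_elast z = (z * (z + 1) - 1) / (z + 1)"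
    using nz by (simp add: zeta_elast_def field_simps)
  have q: "q * m = cmod (z * (z + 1) - 1)"
    using m by (simp add: q_def Qeq norm_divide m_def)
  have "Im (zeta_elast z) = y + y / m\<^sup>2"
    unfolding m2 by (simp add: zeta_elast_def z Im_divide power2_eq_square)
  then have q_Im: "y + y / m\<^sup>2 \<le> q"
    using abs_Im_le_cmod[of "zeta_elast z"] by (simp add: q_def)
  have q0: "q \<ge> 0" by (simp add: q_def)
  \<comment> \<open>In terms of angles this is \<open>\<beta> \<le> Arg z\<close>; it yields
    \<open>sin (\<beta> / 2) \<le> s\<close> below.\<close>
  have cos\<beta>_ge: "x / r \<le> cos \<beta>"
  proof -
    have "\<bar>1 - m\<bar> \<le> r"
      using norm_triangle_ineq3[of 1 "z + 1"] norm_triangle_ineq3[of "z+1" 1] by (simp add: m_def r_def)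
    moreover have "\<bar>x\<bar> \<le> r" by (simp add: x_def r_def abs_Re_le_cmod)
    ultimately have "\<bar>x * (1 - m)\<bar> \<le> r * r"
      unfolding abs_mult by (intro mult_mono) auto
    then have "x * m \<le> r\<^sup>2 + x" by (simp add: algebra_simps power2_eq_square)
    then have "x * m \<le> r * m * cos \<beta>" using cos\<beta> by (simp add: p_def)
    then have "x * m \<le> (r * cos \<beta>) * m" by (simp add: mult_ac)
    then have "x \<le> r * cos \<beta>" using m by (simp only: mult_le_cancel_right_pos)
    then show ?thesis using r by (simp add: field_simps)
  qed
  have sin_half: "(sin (\<beta> / 2))\<^sup>2 = (1 - cos \<beta>) / 2"
    using cos_double_sin[of "\<beta> / 2"] by simp
  have cos_half: "(cos (\<beta> / 2))\<^sup>2 = (1 + cos \<beta>) / 2"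
    using cos_double_cos[of "\<beta> / 2"] by simp
  have sin_half_le: "sin (\<beta> / 2) \<le> s"
  proof (rule power2_le_imp_le[OF _ s0])
    show "(sin (\<beta> / 2))\<^sup>2 \<le> s\<^sup>2" unfolding sin_half s2 using cos\<beta>_ge by (intro divide_right_mono) auto
  qed
  have sin_diff_less: "\<bar>sin ((\<beta> - y) / 2)\<bar> < sin (\<beta> / 2)" if "y < \<beta>"
  proof -
    have "sin ((\<beta> - y) / 2) < sin (\<beta> / 2)"
      using that \<beta> y by (intro sin_monotone_2pi) auto
    moreover have "sin ((\<beta> - y) / 2) \<ge> 0"
      using that \<beta> y by (intro sin_ge_zero) auto
    ultimately show ?thesis by simp
  qed
  have sin_diff_le: "\<bar>sin ((\<beta> - y) / 2)\<bar> \<le> (y - \<beta>) / 2" if "\<beta> \<le> y"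
    using abs_sin_x_le_abs_x[of "(\<beta> - y) / 2"] that by simp
  have "\<bar>sin ((\<beta> - y) / 2)\<bar> < q * s"
  proof (cases "x \<le> 0")
    case x: True
    then have s_half: "s\<^sup>2 \<ge> 1 / 2" using r by (simp add: s2 divide_nonpos_pos)
    then have "s \<ge> 1 / 2"
      by (intro power2_le_imp_le[OF _ s0]) (auto simp: power2_eq_square)
    show ?thesis
    proof (cases "\<beta> \<le> y")
      case True
      have "(y - \<beta>) / 2 < y * (1 / 2)" using \<beta> by simp
      also have "\<dots> \<le> q * s"
        using q_Im \<open>s \<ge> 1 / 2\<close> y m by (intro mult_mono) (auto intro: order_trans[rotated])
      finally show ?thesis using sin_diff_le[OF True] by simp
    next
      case False
      show ?thesis
      \<comment> \<open>Above the segment from -1 to 0 one has \<open>q > 1\<close>, and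
        \<open>sin (\<beta> / 2) \<le> s\<close> is enough. Further left \<open>q\<close> vanishes
        at the critical point -(1 + sqrt 5) / 2, but there \<open>\<beta>\<close> is small as well:
        \<open>sin \<beta> \<le> y / m\<^sup>2 \<le> q\<close>.\<close>
      proof (cases "x \<ge> - 1")
        case True
        have "m < q * m"
          unfolding q
        proof (rule power2_less_imp_less)
          have "0 \<le> - x * (1 + x)" using True x by (intro mult_nonneg_nonneg) auto
          then have 1: "1 + y\<^sup>2 \<le> 1 - x - x\<^sup>2 + y\<^sup>2" by (simp add: algebra_simps power2_eq_square)
          have "(x + 1)\<^sup>2 \<le> 1" using True x by (simp add: power_le_one)
          then have "m\<^sup>2 \<le> 1 + y\<^sup>2" by (simp add: m2)
          also have "\<dots> < (1 + y\<^sup>2)\<^sup>2" using y by (simp add: power2_eq_square algebra_simps add_pos_pos)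
          also have "\<dots> \<le> (1 - x - x\<^sup>2 + y\<^sup>2)\<^sup>2" using 1 by (intro power_mono) auto
          also have "1 - x - x\<^sup>2 + y\<^sup>2 = - Re (z * (z + 1) - 1)"
            by (simp add: z power2_eq_square algebra_simps)
          also have "(- Re (z * (z + 1) - 1))\<^sup>2 \<le> (cmod (z * (z + 1) - 1))\<^sup>2"
            by (simp only: power2_minus cmod_power2) simp
          finally show "m\<^sup>2 < (cmod (z * (z + 1) - 1))\<^sup>2" .
        qed simp
        then have "1 < q" using m by simp
        then have "s \<le> q * s" using s0 by (simp add: mult_le_cancel_right1)
        then show ?thesis using sin_diff_less sin_half_le False by simp
      next
        case x1: False
        have "x * (x + 1) > 0" using x1 by (intro mult_neg_neg) auto
        moreover have "r\<^sup>2 + x = x * (x + 1) + y\<^sup>2"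
          unfolding r2 by (simp add: algebra_simps power2_eq_square)
        ultimately have "r\<^sup>2 + x > 0" by (simp add: add_pos_nonneg)
        then have "cos \<beta> > 0" using cos\<beta> p by (metis zero_less_mult_pos)
        then have "(cos (\<beta> / 2))\<^sup>2 \<ge> 1 / 2" by (simp add: cos_half)
        have "m\<^sup>2 \<le> r\<^sup>2" using x1 unfolding m2 r2 by (simp add: power2_eq_square algebra_simps)
        then have "m \<le> r" using r by (rule_tac power2_le_imp_le) auto
        then have "m\<^sup>2 \<le> p" using m by (simp add: p_def power2_eq_square)
        then have "m\<^sup>2 * sin \<beta> \<le> y" using sin\<beta> sin_gt_zero[OF \<beta>] by (smt (verit) mult_right_mono)
        then have "sin \<beta> \<le> y / m\<^sup>2" using m by (simp add: field_simps)
        then have "sin \<beta> \<le> q" using q_Im y by linarith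
        then have "(sin \<beta>)\<^sup>2 \<le> q\<^sup>2" using sin_gt_zero[OF \<beta>] by (intro power_mono) auto
        have "(sin (\<beta> / 2))\<^sup>2 * 2 \<le> (sin (\<beta> / 2))\<^sup>2 * (4 * (cos (\<beta> / 2))\<^sup>2)"
          using \<open>(cos (\<beta> / 2))\<^sup>2 \<ge> 1 / 2\<close> by (intro mult_left_mono) auto
        also have "\<dots> = (sin \<beta>)\<^sup>2"
          using sin_double[of "\<beta> / 2"] by (simp add: power_mult_distrib)
        also have "\<dots> \<le> q\<^sup>2 * 1" using \<open>(sin \<beta>)\<^sup>2 \<le> q\<^sup>2\<close> by simp
        also have "\<dots> \<le> q\<^sup>2 * (s\<^sup>2 * 2)" using s_half by (intro mult_left_mono) auto
        finally have "(sin (\<beta> / 2))\<^sup>2 \<le> (q * s)\<^sup>2" by (simp add: power_mult_distrib)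
        then have "sin (\<beta> / 2) \<le> q * s" using q0 s0 by (rule_tac power2_le_imp_le) auto
        then show ?thesis using sin_diff_less False by simp
      qed
    qed
  next
    case False
    then have x: "x > 0" by simp
    have "r\<^sup>2 + x > 0" using x by (simp add: add_nonneg_pos)
    then have "cos \<beta> > 0" using cos\<beta> p by (metis zero_less_mult_pos)
    have xr: "x \<le> r" by (simp add: x_def r_def complex_Re_le_cmod)
    have s2': "s\<^sup>2 * (2 * r * (r + x)) = y\<^sup>2"
    proof -
      have "s\<^sup>2 * (2 * r * (r + x)) = r\<^sup>2 - x\<^sup>2"
        unfolding s2 using r by (simp add: field_simps power2_eq_square)
      then show ?thesis by (simp add: r2)
    qed
    show ?thesis
    proof (cases "\<beta> \<le> y")
      case True
      \<comment> \<open>With \<open>p * sin \<beta> = y\<close>, the comparison of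
        \<open>sin \<beta>\<close> with \<open>\<beta>\<close> gives first \<open>p \<ge> 1\<close>
        and then \<open>y / p < \<beta>\<close>. The two factors found below,
        \<open>(p - 1) / m\<close> and \<open>y / (2 * r)\<close>, are lower bounds for
        \<open>q\<close> and \<open>s\<close>.\<close>
      have "y \<le> p * y"
        using sin_x_le_x[of \<beta>] \<beta> True sin\<beta> p by (smt (verit) mult_left_mono)
      then have p1: "p \<ge> 1" using y by simp
      have "sin \<beta> = 2 * sin (\<beta> / 2) * cos (\<beta> / 2)"
        using sin_double[of "\<beta> / 2"] by simp
      also have "\<dots> \<le> \<beta> * cos (\<beta> / 2)"
        using sin_x_le_x[of "\<beta> / 2"] \<beta> by (intro mult_right_mono cos_ge_zero) auto
      also have "\<dots> < \<beta> * 1"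
        using \<beta> cos_monotone_0_pi[of 0 "\<beta> / 2"] by (intro mult_strict_left_mono) auto
      finally have "y / p < \<beta>" using p by (simp add: field_simps flip: sin\<beta>)
      then have "(y - \<beta>) / 2 < (p - 1) * (y / (2 * p))"
        using p by (simp add: field_simps)
      also have "\<dots> = (p - 1) / m * (y / (2 * r))"
        using r m by (simp add: p_def)
      also have "\<dots> \<le> q * s"
      proof (intro mult_mono)
        have "p - 1 \<le> q * m" unfolding q using norm_triangle_ineq2[of "z * (z + 1)" 1]
          by (simp add: p_def r_def m_def norm_mult)
        then show "(p - 1) / m \<le> q" using m by (simp add: field_simps)
        have "y\<^sup>2 \<le> s\<^sup>2 * (2 * r * (2 * r))"
          unfolding s2'[symmetric] using r xr by (intro mult_left_mono) auto
        then have "y\<^sup>2 \<le> (s * (2 * r))\<^sup>2" by (simp add: power2_eq_square mult_ac)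
        then have "y \<le> s * (2 * r)" using s0 r by (rule_tac power2_le_imp_le) auto
        then show "y / (2 * r) \<le> s" using r by (simp add: field_simps)
      qed (use y r q0 in auto)
      finally show ?thesis using sin_diff_le[OF True] by simp
    next
      case False
      define u v where "u = \<beta> / 2" and "v = y / 2"
      have uv: "0 < v" "v < u" "u < pi / 2" using y False \<beta> by (auto simp: u_def v_def)
      have cu: "cos u > 0" using uv by (intro cos_gt_zero) auto
      have rx1: "r\<^sup>2 + x \<le> 1"
      proof -
        have "y * cos \<beta> \<le> \<beta> * cos \<beta>" using False \<open>cos \<beta> > 0\<close> by simp
        also have "\<dots> \<le> sin \<beta>" using \<beta> by (intro mult_cos_le_sin) auto
        finally have "p * (sin \<beta> * cos \<beta>) \<le> 1 * sin \<beta>" by (simp add: mult_ac flip: sin\<beta>)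
        then have "(p * cos \<beta>) * sin \<beta> \<le> 1 * sin \<beta>" by (simp add: mult_ac)
        then have "p * cos \<beta> \<le> 1" using sin_gt_zero[OF \<beta>] by (simp only: mult_le_cancel_right_pos)
        then show ?thesis by (simp add: cos\<beta>)
      qed
      have "p * cos \<beta> \<le> p" using p by simp
      then have rxp: "r\<^sup>2 + x \<le> p" by (simp add: cos\<beta>)
      \<comment> \<open>The factor \<open>2 * p * cos u\<close> turns the half-angle terms into
        \<open>p * sin \<beta> = y\<close> and
        \<open>p * (1 + cos \<beta>) = p + r\<^sup>2 + x\<close>. The chain then passes through
        \<open>- Re (z * (z + 1) - 1)\<close>, a lower bound for \<open>q * m\<close>.\<close>
      have "sin (u - v) * (2 * p * cos u) = p * (2 * sin u * cos u) * cos v - 2 * p * (cos u)\<^sup>2 * sin v"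
        by (simp add: sin_diff algebra_simps power2_eq_square)
      also have "p * (2 * sin u * cos u) = y"
        using sin_double[of u] sin\<beta> by (simp add: u_def)
      also have "2 * p * (cos u)\<^sup>2 = p + r\<^sup>2 + x"
        using cos\<beta> by (simp add: u_def cos_half algebra_simps)
      also have "y * cos v - (p + r\<^sup>2 + x) * sin v \<le> y * cos v - (2 * (r\<^sup>2 + x)) * sin v"
        using rxp uv by (intro diff_left_mono mult_right_mono) (auto intro!: sin_ge_zero)
      also have "\<dots> \<le> y * cos v - (2 * (r\<^sup>2 + x)) * (v * cos v)"
        using uv \<open>r\<^sup>2 + x > 0\<close> by (intro diff_left_mono mult_left_mono mult_cos_le_sin) auto
      also have "\<dots> = y * (1 - (r\<^sup>2 + x)) * cos v" by (simp add: v_def algebra_simps)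
      also have "\<dots> \<le> y * (1 - (r\<^sup>2 + x))" using rx1 y by (intro mult_left_le) auto
      also have "\<dots> < y * (1 - x - x\<^sup>2 + y\<^sup>2)" using y by (intro mult_strict_left_mono) (auto simp: r2)
      also have "\<dots> \<le> y * (q * m)"
      proof -
        have "1 - x - x\<^sup>2 + y\<^sup>2 \<le> q * m"
          unfolding q using abs_Re_le_cmod[of "z * (z + 1) - 1"]
          by (simp add: z power2_eq_square algebra_simps)
        then show ?thesis using y by simp
      qed
      also have "\<dots> \<le> (s * (2 * r * cos u)) * (q * m)"
      proof (rule mult_right_mono)
        have "r + x \<le> 2 * r * (cos u)\<^sup>2"
          using cos\<beta>_ge r by (simp add: u_def cos_half field_simps)
        then have "y\<^sup>2 \<le> s\<^sup>2 * (2 * r * (2 * r * (cos u)\<^sup>2))"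
          unfolding s2'[symmetric] using r by (intro mult_left_mono) auto
        then have "y\<^sup>2 \<le> (s * (2 * r * cos u))\<^sup>2" by (simp add: power2_eq_square mult_ac)
        then show "y \<le> s * (2 * r * cos u)"
          using s0 r cu by (rule_tac power2_le_imp_le) auto
      qed (use q0 m in auto)
      also have "\<dots> = q * s * (2 * p * cos u)" by (simp add: p_def)
      finally have "sin (u - v) < q * s" using p cu by simp
      moreover have "sin (u - v) \<ge> 0" using uv by (intro sin_ge_zero) auto
      ultimately show ?thesis by (simp add: u_def v_def diff_divide_distrib)
    qed
  qed
  then show ?thesis by (simp add: S q_def s_def)
qed


lemma half_sine_cnj [simp]: "half_sine (cnj z) = half_sine z"
  by (simp add: half_sine_def)

lemma zeta_cnj: "zeta lam (cnj z) = cnj (zeta lam z)"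
  by (simp add: zeta_def exp_cnj)

lemma zeta_elast_cnj: "zeta_elast (cnj z) = cnj (zeta_elast z)"
  by (simp add: zeta_elast_def)

definition rzeta :: "real \<Rightarrow> real \<Rightarrow> real" where
  "rzeta lam x = lam * x / (x + 1) * exp (- x)"

lemma zeta_of_real: "zeta lam (of_real x) = of_real (rzeta lam x)"
  by (simp add: zeta_def rzeta_def exp_of_real flip: of_real_minus)

text \<open>Conjugation reduces the claim to the upper half-plane and the negative axis. Left of -1
  the image is a nonnegative real, which is excluded; between -1 and 0 \<open>half_sine z\<close> is
  1 and \<open>zeta_elast z\<close> is below -1.\<close>

lemma half_sine_zeta_less:
  assumes lam: "lam > 0" and z: "z \<notin> \<real>\<^sub>\<ge>\<^sub>0" "z \<noteq> -1" and fz: "zeta lam z \<notin> \<real>\<^sub>\<ge>\<^sub>0"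
  shows "half_sine (zeta lam z) < cmod (zeta_elast z) * half_sine z"
proof -
  consider "Im z > 0" | "Im z < 0" | "Im z = 0" by linarith
  then show ?thesis
  proof cases
    case 1
    then show ?thesis by (rule half_sine_zeta_less_upper[OF lam])
  next
    case 2
    then have "half_sine (zeta lam (cnj z)) < cmod (zeta_elast (cnj z)) * half_sine (cnj z)"
      by (intro half_sine_zeta_less_upper[OF lam]) simp
    then show ?thesis by (simp add: zeta_cnj zeta_elast_cnj)
  next
    case 3
    define x where "x = Re z"
    have zx: "z = of_real x" using 3 by (simp add: x_def complex_eq_iff)
    have x0: "x < 0" using z(1) by (auto simp: zx complex_nonneg_Reals_iff)
    have x1: "x > -1"
    proof (rule ccontr)
      assume "\<not> x > -1"
      then have "x < -1" using z(2) by (auto simp: zx less_le complex_eq_iff)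
      then have "rzeta lam x \<ge> 0"
        unfolding rzeta_def using lam by (intro mult_nonneg_nonneg divide_nonpos_nonpos mult_nonneg_nonpos) auto
      then show False using fz by (simp add: zx zeta_of_real complex_nonneg_Reals_iff)
    qed
    have "half_sine z = 1" using x0 by (simp add: half_sine_def zx)
    moreover have "cmod (zeta_elast z) > 1"
    proof -
      have "zeta_elast z = of_real (zeta_elast x)" by (simp add: zx zeta_elast_def)
      moreover have "1 / (x + 1) > 1" using x0 x1 by (simp add: field_simps)
      then have "zeta_elast x < - 1" using x0 by (simp add: zeta_elast_def)
      ultimately show ?thesis by simp
    qed
    ultimately show ?thesis using half_sine_bounds(2)[of "zeta lam z"] by simp
  qed
qed

text \<open>Schwarz-Pick at the centre of a disc: \<open>k\<close> is \<open>h\<close>, rescaled to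
  the unit disc and followed by the Cayley transform of the right half-plane that sends
  \<open>h z\<close> to 0. The Schwarz lemma bounds its derivative at 0.\<close>

lemma half_plane_deriv_bound:
  assumes r: "r > 0" and holo: "h holomorphic_on ball z r"
    and pos: "\<And>w. w \<in> ball z r \<Longrightarrow> Re (h w) > 0"
  shows "cmod (deriv h z) \<le> 2 * Re (h z) / r"
proof -
  define k where "k = (\<lambda>\<zeta>. (h (z + of_real r * \<zeta>) - h z) / (h (z + of_real r * \<zeta>) + cnj (h z)))"
  have in_ball: "z + of_real r * \<zeta> \<in> ball z r" if "norm \<zeta> < 1" for \<zeta>
    using r that by (simp add: dist_norm norm_mult)
  have hz: "Re (h z) > 0" using pos[of z] r by simp
  have nz: "h (z + of_real r * \<zeta>) + cnj (h z) \<noteq> 0" if "norm \<zeta> < 1" for \<zeta>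
    using pos[OF in_ball[OF that]] hz by (auto simp: complex_eq_iff)
  have comp: "(\<lambda>\<zeta>. h (z + of_real r * \<zeta>)) holomorphic_on ball 0 1"
    by (rule holomorphic_on_compose_gen[of "\<lambda>\<zeta>. z + of_real r * \<zeta>" _ h "ball z r", unfolded o_def])
       (use in_ball holo in \<open>auto intro!: holomorphic_intros\<close>)
  have holk: "k holomorphic_on ball 0 1"
    unfolding k_def using nz by (intro holomorphic_intros comp) auto
  have k0: "k 0 = 0" by (simp add: k_def)
  have k1: "norm (k \<zeta>) < 1" if "norm \<zeta> < 1" for \<zeta>
  proof -
    define b where "b = h (z + of_real r * \<zeta>)"
    have b: "Re b > 0" using pos[OF in_ball[OF that]] by (simp add: b_def)
    have "(cmod (b - h z))\<^sup>2 < (cmod (b + cnj (h z)))\<^sup>2"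
      unfolding cmod_power2 using mult_pos_pos[OF b hz] by (simp add: power2_eq_square algebra_simps)
    then have "cmod (b - h z) < cmod (b + cnj (h z))" by (rule power2_less_imp_less) simp
    then show ?thesis unfolding k_def b_def[symmetric] norm_divide
      by (subst divide_less_eq_1_pos) (auto intro: le_less_trans[OF norm_ge_zero])
  qed
  have "norm (deriv k 0) \<le> 1" using Schwarz_Lemma(2)[OF holk k0 k1, of 0] by simp
  moreover have "deriv k 0 = of_real r * deriv h z / (2 * of_real (Re (h z)))"
  proof (rule DERIV_imp_deriv)
    have dh: "(h has_field_derivative deriv h z) (at (z + of_real r * 0))"
      using holomorphic_derivI[OF holo, of z] r by simp
    have "((\<lambda>\<zeta>. h (z + of_real r * \<zeta>)) has_field_derivative deriv h z * of_real r) (at 0)"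
      by (rule DERIV_chain2[where f = h and x = 0 and g = "\<lambda>\<zeta>. z + of_real r * \<zeta>", OF dh]) (auto intro!: derivative_eq_intros)
    moreover have "h z + cnj (h z) = 2 * of_real (Re (h z))"
      by (simp add: complex_eq_iff)
    ultimately show "(k has_field_derivative of_real r * deriv h z / (2 * of_real (Re (h z)))) (at 0)"
      unfolding k_def using nz[of 0] hz
      by (auto intro!: derivative_eq_intros simp: field_simps)
  qed
  ultimately have "r * cmod (deriv h z) / (2 * Re (h z)) \<le> 1"
    using r hz by (simp add: norm_mult norm_divide)
  then show ?thesis using r hz by (simp add: field_simps)
qed

text \<open>The root of \<open>- w\<close> maps the slit plane onto the right half-plane, and this
  formula transports the half-plane density \<open>1 / Re\<close> back to the slit plane.\<close>

lemma Re_csqrt_uminus: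
  assumes "w \<noteq> 0"
  shows "Re (csqrt (- w)) = sqrt (cmod w) * half_sine w"
  using assms by (simp add: half_sine_def field_simps flip: real_sqrt_mult)

text \<open>Schwarz-Pick for the slit plane, obtained from the half-plane through
  \<open>csqrt (- F w)\<close>. The factor \<open>4 / r\<close> combines the density
  \<open>2 / r\<close> of the disc at its centre with the 2 in the slit-plane density
  \<open>1 / (2 * cmod w * half_sine w)\<close>.\<close>

lemma slit_plane_deriv_bound:
  assumes r: "r > 0" and holo: "F holomorphic_on ball z r"
    and slit: "\<And>w. w \<in> ball z r \<Longrightarrow> F w \<notin> \<real>\<^sub>\<ge>\<^sub>0"
  shows "cmod (deriv F z) \<le> 4 / r * (cmod (F z) * half_sine (F z))"
proof -
  have neg: "- F w \<notin> \<real>\<^sub>\<le>\<^sub>0" if "w \<in> ball z r" for w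
    using slit[OF that] by (simp add: complex_nonpos_Reals_iff complex_nonneg_Reals_iff)
  define h where "h = (\<lambda>w. csqrt (- F w))"
  have holh: "h holomorphic_on ball z r"
    unfolding h_def using neg by (intro holomorphic_intros holo) auto
  have "Re (h w) > 0" if "w \<in> ball z r" for w
  proof (rule ccontr)
    assume "\<not> Re (h w) > 0"
    then have "Re (h w) = 0" using Re_csqrt[of "- F w"] by (simp add: h_def)
    moreover have "- F w = (h w)\<^sup>2" by (simp add: h_def)
    ultimately have "- F w \<in> \<real>\<^sub>\<le>\<^sub>0" by (simp add: complex_nonpos_Reals_iff power2_eq_square)
    then show False using neg[OF that] by simp
  qed
  note bound = half_plane_deriv_bound[OF r holh this]
  have zr: "z \<in> ball z r" using r by simp
  have "(F has_field_derivative deriv F z) (at z)"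
    using holomorphic_derivI[OF holo _ zr] by simp
  then have "(h has_field_derivative - deriv F z / (2 * h z)) (at z)"
    unfolding h_def using neg[OF zr] by (auto intro!: derivative_eq_intros)
  then have "deriv h z = - deriv F z / (2 * h z)" by (rule DERIV_imp_deriv)
  then have "cmod (deriv F z) = 2 * cmod (h z) * cmod (deriv h z)"
    using neg[OF zr] by (auto simp: h_def norm_divide norm_mult)
  also have "\<dots> \<le> 2 * cmod (h z) * (2 * Re (h z) / r)"
    using bound by (intro mult_left_mono) auto
  also have "\<dots> = 4 / r * (cmod (h z) * Re (h z))" by simp
  also have "cmod (h z) * Re (h z) = cmod (F z) * half_sine (F z)"
  proof -
    have "F z \<noteq> 0" using slit[OF zr] by auto
    then show ?thesis unfolding h_def Re_csqrt_uminus[OF \<open>F z \<noteq> 0\<close>] by simp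
  qed
  finally show ?thesis .
qed

section \<open>Dynamics on the positive real axis\<close>

text \<open>For positive \<open>lam\<close> and \<open>x\<close>,
  \<open>rzeta lam x = lam * x * exp (- logweight x)\<close>. At a positive fixed point
  \<open>a\<close> therefore \<open>logweight a = ln lam\<close>, and
  \<open>logweight x - logweight a\<close> equals \<open>ln x - ln (rzeta lam x)\<close>.\<close>

definition logweight :: "real \<Rightarrow> real" where
  "logweight x = x + ln (1 + x)"

lemma rzeta_pos: "lam > 0 \<Longrightarrow> x > 0 \<Longrightarrow> rzeta lam x > 0"
  by (simp add: rzeta_def)

lemma has_real_derivative_rzeta:
  assumes "x > 0"
  shows "(rzeta lam has_real_derivative - (rzeta lam x * zeta_elast x / x)) (at x)"
  unfolding rzeta_def zeta_elast_def
  using assms by (auto intro!: derivative_eq_intros simp: divide_simps) (auto simp: algebra_simps)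

lemma has_real_derivative_logweight:
  assumes "x > 0"
  shows "(logweight has_real_derivative (zeta_elast x + 1) / x) (at x)"
  unfolding logweight_def zeta_elast_def
  using assms by (auto intro!: derivative_eq_intros simp: divide_simps) (auto simp: algebra_simps)

lemma has_real_derivative_zeta_elast:
  fixes x :: real
  assumes "x > 0"
  shows "(zeta_elast has_real_derivative 1 + 1 / (x + 1)\<^sup>2) (at x)"
  unfolding zeta_elast_def
  using assms by (auto intro!: derivative_eq_intros simp: power2_eq_square)

lemma zeta_elast_strict_mono:
  fixes x y :: real
  assumes "0 \<le> x" "x < y"
  shows "zeta_elast x < zeta_elast y"
proof -
  have "1 / (y + 1) \<le> 1 / (x + 1)" using assms by (intro divide_left_mono) auto
  then show ?thesis using assms by (simp add: zeta_elast_def)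
qed

lemma zeta_elast_sqrt2: "zeta_elast (sqrt 2) = (1 :: real)"
proof -
  have "sqrt 2 + 1 \<noteq> (0::real)" by (smt (verit) real_sqrt_ge_zero)
  then show ?thesis by (simp add: zeta_elast_def field_simps)
qed

text \<open>A positive fixed point \<open>x\<close> has multiplier \<open>- zeta_elast x\<close>; at
  this parameter the fixed point is \<open>sqrt 2\<close>, with multiplier -1.\<close>

abbreviation (input) "lamstar \<equiv> (sqrt 2 + 1) * exp (sqrt 2)"

lemma rzeta_lamstar_sqrt2: "rzeta lamstar (sqrt 2) = sqrt 2"
proof -
  have "sqrt 2 + 1 \<noteq> (0::real)" by (smt (verit) real_sqrt_ge_zero)
  then show ?thesis by (simp add: rzeta_def exp_minus)
qed

text \<open>For $q = \mathrm{zeta\_elast} > 0$ this compares $x q'(x) / q(x)$ with its value $4 \sqrt 2 - 4$ at $x = \sqrt 2$.\<close>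
lemma zeta_elast_derivative_eq:
  fixes x :: real
  assumes "0 < x"
  obtains c :: real where "c \<ge> 0"
    "x * (1 + 1 / (x + 1)\<^sup>2) = (4 * sqrt 2 - 4) * zeta_elast x + c * (sqrt 2 - x)"
proof
  define s where "s = sqrt (2::real)"
  have s: "s * s = 2" by (simp add: s_def)
  have s1: "s \<ge> 5 / 4" unfolding s_def by (rule real_le_rsqrt) (simp add: power2_eq_square)
  have s2: "s \<le> 3 / 2" unfolding s_def by (rule real_le_lsqrt) (simp_all add: power2_eq_square)
  \<comment> \<open>At \<open>x = s\<close> both sides of the claimed identity agree, so
    \<open>s - x\<close> divides their difference once \<open>s * s = 2\<close> is used, and
    \<open>N\<close> is the quotient. Its coefficients are nonnegative by
    \<open>5 / 4 \<le> s \<le> 3 / 2\<close>.\<close>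
  define N where "N = (4 * s - 5) * x\<^sup>2 + (3 * s - 2) * x + (4 - 2 * s)"
  define c where "c = N / (x + 1)\<^sup>2"
  show "c \<ge> 0"
    unfolding c_def N_def using s1 s2 assms by (intro divide_nonneg_pos add_nonneg_nonneg mult_nonneg_nonneg) auto
  have "x * ((x + 1)\<^sup>2 + 1) = (4 * s - 4) * ((x * (x + 1) - 1) * (x + 1)) +
     N * (s - x) - (4 * x\<^sup>2 + 3 * x - 2) * (s * s - 2)"
    by (simp add: N_def algebra_simps power2_eq_square)
  then have "x * ((x + 1)\<^sup>2 + 1) / (x + 1)\<^sup>2 = (4 * s - 4) * ((x * (x + 1) - 1) * (x + 1) / (x + 1)\<^sup>2) + c * (s - x)"
    by (simp add: s c_def add_divide_distrib)
  moreover have "x * ((x + 1)\<^sup>2 + 1) / (x + 1)\<^sup>2 = x * (1 + 1 / (x + 1)\<^sup>2)"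
    using assms by (simp add: field_simps)
  moreover have "(x * (x + 1) - 1) * (x + 1) / (x + 1)\<^sup>2 = zeta_elast x"
    using assms by (simp add: zeta_elast_def divide_simps power2_eq_square)
  ultimately show "x * (1 + 1 / (x + 1)\<^sup>2) = (4 * sqrt 2 - 4) * zeta_elast x + c * (sqrt 2 - x)"
    by (simp add: s_def)
qed

lemma rzeta_antimono:
  assumes "lam > 0" "0 < x" "zeta_elast x \<ge> 0" "x \<le> y"
  shows "rzeta lam y \<le> rzeta lam x"
proof (rule DERIV_nonpos_imp_nonincreasing[OF assms(4)])
  fix t assume t: "x \<le> t" "t \<le> y"
  have "zeta_elast t \<ge> 0"
    using zeta_elast_strict_mono[of x t] assms t by (cases "x = t") auto
  then have "- (rzeta lam t * zeta_elast t / t) \<le> 0"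
    using t assms rzeta_pos[of lam t] by auto
  then show "\<exists>d. (rzeta lam has_real_derivative d) (at t) \<and> d \<le> 0"
    using has_real_derivative_rzeta[of t lam] t assms by auto
qed

text \<open>The left-hand side is maximal at the neutral fixed point $\sqrt 2$, with value $1$.\<close>
lemma zeta_elast_product_lamstar:
  assumes x: "x > 0" "zeta_elast x > 0"
  shows "zeta_elast x * zeta_elast (rzeta lamstar x) \<le> 1"
proof -
  define f where "f = rzeta lamstar"
  define k :: real where "k = 4 * sqrt 2 - 4"
  have lpos: "lamstar > 0" by (intro mult_pos_pos add_pos_pos) auto
  have k: "k > 0" by (simp add: k_def)
  define L where "L = (\<lambda>t. zeta_elast t * zeta_elast (f t))"
  define L' where "L' = (\<lambda>t. (1 + 1 / (t + 1)\<^sup>2) * zeta_elast (f t)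
      - zeta_elast t * ((1 + 1 / (f t + 1)\<^sup>2) * (f t * zeta_elast t / t)))"
  have der: "(L has_real_derivative L' t) (at t)" if "t > 0" for t
  proof -
    have "((\<lambda>t. zeta_elast (f t)) has_real_derivative (1 + 1 / (f t + 1)\<^sup>2) * - (f t * zeta_elast t / t)) (at t)"
      unfolding f_def using that lpos rzeta_pos
      by (intro DERIV_chain2[where f = zeta_elast] has_real_derivative_zeta_elast has_real_derivative_rzeta) auto
    from DERIV_mult[OF has_real_derivative_zeta_elast[OF that] this]
    show ?thesis unfolding L_def L'_def by (simp add: algebra_simps)
  qed
  have L's: "t * L' t = t * (1 + 1 / (t + 1)\<^sup>2) * zeta_elast (f t)
       - (zeta_elast t)\<^sup>2 * (f t * (1 + 1 / (f t + 1)\<^sup>2))" if "t > 0" for t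
    unfolding L'_def using that by (simp add: right_diff_distrib power2_eq_square mult_ac)
  have fpos: "f t > 0" if "t > 0" for t using that lpos rzeta_pos by (simp add: f_def)
  have L1: "L (sqrt 2) = 1" by (simp add: L_def f_def rzeta_lamstar_sqrt2 zeta_elast_sqrt2)
  have "L x \<le> L (sqrt 2)"
  proof (cases "x \<le> sqrt 2")
    case True
    show ?thesis
    proof (rule DERIV_nonneg_imp_nondecreasing[OF True])
      \<comment> \<open>Here \<open>f t\<close> lies on the other side of \<open>sqrt 2\<close>, so
        the comparison identity bounds the first term of \<open>t * L' t\<close> from below and the
        subtracted one from above. Together, \<open>t * L' t\<close> is at least
        \<open>k * zeta_elast t * zeta_elast (f t) * (1 - zeta_elast t)\<close>.\<close>
      fix t assume t: "x \<le> t" "t \<le> sqrt 2"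
      have t0: "t > 0" using t x by simp
      have Qt: "zeta_elast t > 0" "zeta_elast t \<le> 1"
        using zeta_elast_strict_mono[of x t] x t zeta_elast_strict_mono[of t "sqrt 2"] t0 zeta_elast_sqrt2
        by (cases "x = t"; cases "t = sqrt 2"; auto)+
      have ft: "f t \<ge> sqrt 2"
        using rzeta_antimono[OF lpos t0 _ t(2)] Qt by (simp add: rzeta_lamstar_sqrt2 f_def)
      then have Qft: "zeta_elast (f t) \<ge> 1"
        using zeta_elast_strict_mono[of "sqrt 2" "f t"] zeta_elast_sqrt2 by (cases "f t = sqrt 2") auto
      obtain c where c: "c \<ge> 0" "t * (1 + 1 / (t + 1)\<^sup>2) = k * zeta_elast t + c * (sqrt 2 - t)"
        using zeta_elast_derivative_eq[OF t0] unfolding k_def by blast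
      obtain d where d: "d \<ge> 0" "f t * (1 + 1 / (f t + 1)\<^sup>2) = k * zeta_elast (f t) + d * (sqrt 2 - f t)"
        using zeta_elast_derivative_eq[OF fpos[OF t0]] unfolding k_def by blast
      have "(zeta_elast t)\<^sup>2 * (f t * (1 + 1 / (f t + 1)\<^sup>2)) \<le> (zeta_elast t)\<^sup>2 * (k * zeta_elast (f t))"
        using d ft by (intro mult_left_mono) (auto simp: mult_nonneg_nonpos)
      also have "\<dots> \<le> zeta_elast t * (k * zeta_elast (f t))"
        using Qt Qft k by (intro mult_right_mono) (auto simp: power2_eq_square mult_le_one)
      also have "\<dots> = (k * zeta_elast t) * zeta_elast (f t)" by simp
      also have "\<dots> \<le> t * (1 + 1 / (t + 1)\<^sup>2) * zeta_elast (f t)"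
        using Qft c t by (intro mult_right_mono) auto
      finally have "t * L' t \<ge> 0" unfolding L's[OF t0] by linarith
      then have "L' t \<ge> 0" using t0 by (simp add: zero_le_mult_iff)
      then show "\<exists>y. (L has_real_derivative y) (at t) \<and> 0 \<le> y" using der[OF t0] by blast
    qed
  next
    case False
    then have "sqrt 2 \<le> x" by simp
    then show ?thesis
    proof (rule DERIV_nonpos_imp_nonincreasing)
      fix t assume t: "sqrt 2 \<le> t" "t \<le> x"
      have t0: "t > 0" using t by (smt (verit) real_sqrt_gt_zero)
      have Qt: "zeta_elast t \<ge> 1"
        using zeta_elast_strict_mono[of "sqrt 2" t] t zeta_elast_sqrt2
        by (cases "t = sqrt 2") auto
      have ft: "f t \<le> sqrt 2"
        using rzeta_antimono[OF lpos _ _ t(1)] by (simp add: rzeta_lamstar_sqrt2 f_def zeta_elast_sqrt2)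
      obtain c where c: "c \<ge> 0" "t * (1 + 1 / (t + 1)\<^sup>2) = k * zeta_elast t + c * (sqrt 2 - t)"
        using zeta_elast_derivative_eq[OF t0] unfolding k_def by blast
      obtain d where d: "d \<ge> 0" "f t * (1 + 1 / (f t + 1)\<^sup>2) = k * zeta_elast (f t) + d * (sqrt 2 - f t)"
        using zeta_elast_derivative_eq[OF fpos[OF t0]] unfolding k_def by blast
      \<comment> \<open>To the right of \<open>sqrt 2\<close> all inequalities are reversed. Now
        \<open>zeta_elast (f t)\<close> may be negative, and then the two sides have opposite
        signs.\<close>
      have "t * (1 + 1 / (t + 1)\<^sup>2) * zeta_elast (f t) \<le> (zeta_elast t)\<^sup>2 * (f t * (1 + 1 / (f t + 1)\<^sup>2))"
      proof (cases "zeta_elast (f t) \<ge> 0")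
        case True
        have "t * (1 + 1 / (t + 1)\<^sup>2) * zeta_elast (f t) \<le> (k * zeta_elast t) * zeta_elast (f t)"
          using c t True by (intro mult_right_mono) (auto simp: mult_nonneg_nonpos)
        also have "\<dots> = zeta_elast t * (k * zeta_elast (f t))" by simp
        also have "\<dots> \<le> (zeta_elast t)\<^sup>2 * (k * zeta_elast (f t))"
          using Qt True k by (intro mult_right_mono) (auto simp: power2_eq_square)
        also have "\<dots> \<le> (zeta_elast t)\<^sup>2 * (f t * (1 + 1 / (f t + 1)\<^sup>2))"
          using d ft by (intro mult_left_mono) auto
        finally show ?thesis .
      next
        case False
        have "t * (1 + 1 / (t + 1)\<^sup>2) * zeta_elast (f t) \<le> 0"
          using False t0 by (intro mult_nonneg_nonpos) auto
        also have "0 \<le> (zeta_elast t)\<^sup>2 * (f t * (1 + 1 / (f t + 1)\<^sup>2))"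
          using fpos[OF t0] by (intro mult_nonneg_nonneg) auto
        finally show ?thesis .
      qed
      then have "t * L' t \<le> 0" unfolding L's[OF t0] by linarith
      then have "L' t \<le> 0" using t0 by (simp add: mult_le_0_iff)
      then show "\<exists>y. (L has_real_derivative y) (at t) \<and> y \<le> 0" using der[OF t0] by blast
    qed
  qed
  then show ?thesis using L1 by (simp add: L_def f_def)
qed

text \<open>Lowering \<open>lam\<close> from \<open>lamstar\<close> strictly lowers the second
  factor, which settles positive \<open>zeta_elast x\<close>. If both factors are nonpositive, each
  still exceeds -1.\<close>

lemma zeta_elast_product_less:
  assumes lam: "0 < lam" "lam < lamstar" and x: "x > 0"
  shows "zeta_elast x * zeta_elast (rzeta lam x) < 1"
proof -
  have gt: "zeta_elast t > - 1" if "t > 0" for t :: real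
    using zeta_elast_strict_mono[of 0 t] that by (simp add: zeta_elast_def)
  have fx: "rzeta lam x > 0" using rzeta_pos lam x by simp
  show ?thesis
  proof (cases "zeta_elast x > 0")
    case True
    have "rzeta lam x < rzeta lamstar x"
      unfolding rzeta_def using lam x by (intro mult_strict_right_mono divide_strict_right_mono) auto
    then have "zeta_elast (rzeta lam x) < zeta_elast (rzeta lamstar x)"
      using fx by (intro zeta_elast_strict_mono) auto
    then have "zeta_elast x * zeta_elast (rzeta lam x) < zeta_elast x * zeta_elast (rzeta lamstar x)"
      using True by simp
    then show ?thesis using zeta_elast_product_lamstar[OF x True] by simp
  next
    case False
    show ?thesis
    proof (cases "zeta_elast (rzeta lam x) > 0")
      case True
      then have "zeta_elast x * zeta_elast (rzeta lam x) \<le> 0"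
        using False by (simp add: mult_nonpos_nonneg)
      then show ?thesis by simp
    next
      case F: False
      have "(- zeta_elast x) * (- zeta_elast (rzeta lam x)) < 1 * 1"
        using gt[OF x] gt[OF fx] False F by (intro mult_strict_mono') auto
      then show ?thesis by simp
    qed
  qed
qed

section \<open>A Lyapunov function for the positive orbits\<close>

lemma logweight_diff_ge:
  assumes "0 < x" "x \<le> y"
  shows "y - x \<le> logweight y - logweight x"
  using assms by (simp add: logweight_def)

text \<open>The derivative of the sum is
  \<open>(1 - zeta_elast x * zeta_elast (rzeta lam x)) / x\<close>, positive by the product
  estimate.\<close>

lemma logweight_zeta_add_strict_mono:
  assumes lam: "0 < lam" "lam < lamstar" and xy: "0 < x" "x < y"
  shows "logweight (rzeta lam x) + logweight x < logweight (rzeta lam y) + logweight y"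
proof (rule DERIV_pos_imp_increasing[OF xy(2)])
  fix t assume t: "x \<le> t" "t \<le> y"
  have t0: "t > 0" using t xy by simp
  have ft: "rzeta lam t > 0" using t0 lam rzeta_pos by simp
  have "((\<lambda>t. logweight (rzeta lam t) + logweight t) has_real_derivative
      ((zeta_elast (rzeta lam t) + 1) / rzeta lam t) * - (rzeta lam t * zeta_elast t / t) + (zeta_elast t + 1) / t) (at t)"
    using t0 ft by (intro DERIV_add DERIV_chain2[where f = logweight] has_real_derivative_logweight has_real_derivative_rzeta)
  moreover have "((zeta_elast (rzeta lam t) + 1) / rzeta lam t) * - (rzeta lam t * zeta_elast t / t) + (zeta_elast t + 1) / t
     = (1 - zeta_elast t * zeta_elast (rzeta lam t)) / t"
    using t0 ft by (simp add: field_simps)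
  moreover have "\<dots> > 0" using zeta_elast_product_less[OF lam t0] t0 by simp
  ultimately show "\<exists>d. ((\<lambda>t. logweight (rzeta lam t) + logweight t) has_real_derivative d) (at t) \<and> 0 < d"
    by metis
qed

text \<open>With \<open>lam\<close> eliminated by the fixed point equation, the factor after
  \<open>x\<close> is visibly above 1 for \<open>x < a\<close> and below 1 for
  \<open>x > a\<close>.\<close>

lemma rzeta_conv_fixpoint:
  assumes "rzeta lam a = a" "a > 0" "x > 0"
  shows "rzeta lam x = x * ((a + 1) / (x + 1) * exp (a - x))"
proof -
  have "a * lam = a * ((a + 1) * exp a)"
    using assms(1,2) by (simp add: rzeta_def exp_minus divide_simps mult_ac)
  then have "lam = (a + 1) * exp a" using assms(2) by simp
  then show ?thesis by (simp add: rzeta_def exp_diff exp_minus field_simps)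
qed

lemma rzeta_fixpoint_compare:
  assumes "rzeta lam a = a" "a > 0" "x > 0"
  shows "x < a \<Longrightarrow> x < rzeta lam x" "a < x \<Longrightarrow> rzeta lam x < x"
proof -
  assume "x < a"
  have "1 * 1 < (a + 1) / (x + 1) * exp (a - x)"
    using \<open>x < a\<close> assms by (intro mult_strict_mono) (auto simp: field_simps)
  from mult_strict_left_mono[OF this assms(3)]
  show "x < rzeta lam x" unfolding rzeta_conv_fixpoint[OF assms] by simp
next
  assume "a < x"
  have "(a + 1) / (x + 1) * exp (a - x) < 1 * 1"
    using \<open>a < x\<close> assms by (intro mult_strict_mono) (auto simp: field_simps)
  from mult_strict_left_mono[OF this assms(3)]
  show "rzeta lam x < x" unfolding rzeta_conv_fixpoint[OF assms] by simp
qed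

text \<open>The new \<open>logweight\<close> lies strictly between the old one and its mirror image
  in \<open>logweight a\<close>: one bound says that the orbit moves towards \<open>a\<close>, the
  other that it does not overshoot too far, by comparing the strictly increasing sum at
  \<open>x\<close> and \<open>a\<close>.\<close>

lemma logweight_lyapunov:
  assumes lam: "0 < lam" "lam < lamstar" and a: "rzeta lam a = a" "a > 0" and x: "x > 0" "x \<noteq> a"
  shows "\<bar>logweight (rzeta lam x) - logweight a\<bar> < \<bar>logweight x - logweight a\<bar>"
proof -
  note fx = rzeta_pos[OF lam(1) x(1)]
  show ?thesis
  proof (cases "x < a")
    case True
    have "logweight x < logweight a" using logweight_diff_ge[of x a] x True by simp
    moreover have "logweight x < logweight (rzeta lam x)"
      using logweight_diff_ge[of x "rzeta lam x"] rzeta_fixpoint_compare(1)[OF a x(1) True] x by simp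
    moreover have "logweight (rzeta lam x) + logweight x < 2 * logweight a"
      using logweight_zeta_add_strict_mono[OF lam x(1) True] a by simp
    ultimately show ?thesis by linarith
  next
    case False
    then have ax: "a < x" using x by simp
    have "logweight x > logweight a" using logweight_diff_ge[of a x] a ax by simp
    moreover have "logweight x > logweight (rzeta lam x)"
      using logweight_diff_ge[of "rzeta lam x" x] rzeta_fixpoint_compare(2)[OF a x(1) ax] fx by simp
    moreover have "logweight (rzeta lam x) + logweight x > 2 * logweight a"
      using logweight_zeta_add_strict_mono[OF lam a(2) ax] a by simp
    ultimately show ?thesis by linarith
  qed
qed

text \<open>Lyapunov argument: the orbit stays in a compact part of the positive axis, and at any
  cluster point \<open>V\<close> is not decreased by \<open>rzeta\<close>, so the cluster point is
  \<open>a\<close> and the limit of \<open>V\<close> along the orbit is 0.\<close>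

lemma rzeta_iterates_tendsto:
  assumes lam: "0 < lam" "lam < lamstar" and a: "rzeta lam a = a" "a > 0" and x: "x > 0"
  shows "(\<lambda>n. (rzeta lam ^^ n) x) \<longlonglongrightarrow> a"
proof -
  define X where "X = (\<lambda>n. (rzeta lam ^^ n) x)"
  define V where "V = (\<lambda>x. \<bar>logweight x - logweight a\<bar>)"
  have X_Suc: "X (Suc n) = rzeta lam (X n)" for n by (simp add: X_def)
  have pos: "X n > 0" for n
    by (induction n) (use x lam rzeta_pos in \<open>auto simp: X_def\<close>)
  have V_step: "V (X (Suc n)) \<le> V (X n)" for n
    using logweight_lyapunov[OF lam a pos[of n]] a by (cases "X n = a") (auto simp: X_Suc V_def)
  then have dec: "decseq (\<lambda>n. V (X n))" by (rule decseq_SucI)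
  have "V (X n) \<ge> 0" for n by (simp add: V_def)
  then obtain l where l: "(\<lambda>n. V (X n)) \<longlonglongrightarrow> l"
    using decseq_convergent[OF dec, of 0] by metis
  have close: "\<bar>t - a\<bar> \<le> V t" if "t > 0" for t
    using logweight_diff_ge[of t a] logweight_diff_ge[of a t] that a by (cases "t \<le> a") (auto simp: V_def)
  define B where "B = a + V x"
  have aB: "a \<le> B" by (simp add: B_def V_def)
  have XB: "X n \<le> B" for n
    using close[OF pos[of n]] decseqD[OF dec, of 0 n] by (auto simp: B_def X_def)
  have cont: "continuous_on {0<..} (rzeta lam)"
    using has_real_derivative_rzeta by (intro continuous_at_imp_continuous_on) (auto intro: DERIV_isCont)
  have "continuous_on {a..B} (rzeta lam)"
    by (rule continuous_on_subset[OF cont]) (use a in auto)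
  then obtain t0 where t0: "t0 \<in> {a..B}" "\<And>t. t \<in> {a..B} \<Longrightarrow> rzeta lam t0 \<le> rzeta lam t"
    using continuous_attains_inf[of "{a..B}" "rzeta lam"] aB by auto
  \<comment> \<open>A lower bound for the orbit: points below \<open>a\<close> move up, and points
    in \<open>{a..B}\<close> have image at least the minimum \<open>rzeta lam t0\<close>.\<close>
  define m where "m = min x (rzeta lam t0)"
  have m: "m > 0" using x rzeta_pos[OF lam(1), of t0] t0 a by (simp add: m_def)
  have Xm: "m \<le> X n" for n
  proof (induction n)
    case 0
    then show ?case by (simp add: X_def m_def)
  next
    case (Suc n)
    show ?case
    proof (cases "X n < a")
      case True
      then show ?thesis using rzeta_fixpoint_compare(1)[OF a pos[of n]] Suc by (simp add: X_Suc)
    next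
      case False
      then show ?thesis using t0(2)[of "X n"] XB[of n] by (simp add: X_Suc m_def)
    qed
  qed
  have "seq_compact {m..B}" by (simp add: compact_imp_seq_compact)
  then obtain c r where c: "c \<in> {m..B}" and r: "strict_mono r" and lim: "(X \<circ> r) \<longlonglongrightarrow> c"
    using Xm XB by (elim seq_compactE[where f = X]) auto
  have c0: "c > 0" using c m by simp
  have contV: "isCont V t" if "t > 0" for t
    unfolding V_def using DERIV_isCont[OF has_real_derivative_logweight[OF that]] by (intro continuous_intros)
  have "(\<lambda>n. V ((X \<circ> r) n)) \<longlonglongrightarrow> V c"
    by (rule isCont_tendsto_compose[OF contV[OF c0] lim])
  moreover have "(\<lambda>n. V ((X \<circ> r) n)) \<longlonglongrightarrow> l"
    using LIMSEQ_subseq_LIMSEQ[OF l r] by (simp add: o_def)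
  ultimately have Vc: "V c = l" by (rule LIMSEQ_unique)
  have "(\<lambda>n. rzeta lam ((X \<circ> r) n)) \<longlonglongrightarrow> rzeta lam c"
    by (rule isCont_tendsto_compose[OF DERIV_isCont[OF has_real_derivative_rzeta[OF c0]] lim])
  then have "(\<lambda>n. V (rzeta lam ((X \<circ> r) n))) \<longlonglongrightarrow> V (rzeta lam c)"
    by (rule isCont_tendsto_compose[OF contV[OF rzeta_pos[OF lam(1) c0]]])
  moreover have "(\<lambda>n. V (rzeta lam ((X \<circ> r) n))) \<longlonglongrightarrow> l"
    using LIMSEQ_subseq_LIMSEQ[OF LIMSEQ_Suc[OF l] r] by (simp add: o_def X_Suc)
  ultimately have "V (rzeta lam c) = V c" unfolding Vc by (rule LIMSEQ_unique)
  then have "c = a" using logweight_lyapunov[OF lam a c0] by (auto simp: V_def)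
  then have "l = 0" using Vc by (simp add: V_def)
  have "(\<lambda>n. X n - a) \<longlonglongrightarrow> 0"
    by (rule Lim_null_comparison[OF _ l[unfolded \<open>l = 0\<close>]]) (use close pos in auto)
  then show ?thesis by (simp add: X_def LIM_zero_iff)
qed

section \<open>The chordal metric and fixed points\<close>

lemma chordal_le: "chordal (Some b) (Some c) \<le> 2 * dist b c"
proof -
  have "1 * 1 \<le> sqrt (1 + (cmod b)\<^sup>2) * sqrt (1 + (cmod c)\<^sup>2)"
    by (intro mult_mono) auto
  then have "2 * cmod (b - c) / (sqrt (1 + (cmod b)\<^sup>2) * sqrt (1 + (cmod c)\<^sup>2)) \<le> 2 * cmod (b - c) / 1"
    by (intro divide_left_mono) (auto intro!: mult_pos_pos add_pos_nonneg)
  then show ?thesis by (simp add: dist_norm)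
qed

lemma sball_subset_ball:
  assumes "\<eta> > 0"
  obtains \<delta> where "\<delta> > 0" "sball (Some w) \<delta> \<subseteq> Some ` ball w \<eta>"
proof
  define K where "K = sqrt (1 + (cmod w)\<^sup>2)"
  \<comment> \<open>The first bound excludes infinity and absorbs the dependence of \<open>M\<close>
    on \<open>t\<close>, giving \<open>2 * t < \<eta> + t\<close>; the second one produces the
    \<open>\<eta>\<close>.\<close>
  define \<delta> where "\<delta> = min (1 / K) (\<eta> / (K * (1 + cmod w)))"
  have K: "K > 0" by (auto simp: K_def intro!: add_pos_nonneg)
  have w1: "1 + cmod w > 0" by (simp add: add_pos_nonneg)
  show "\<delta> > 0" using K w1 assms by (simp add: \<delta>_def)
  show "sball (Some w) \<delta> \<subseteq> Some ` ball w \<eta>"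
  proof
    fix v assume v: "v \<in> sball (Some w) \<delta>"
    have d1: "\<delta> * K \<le> 1"
      using K by (simp add: \<delta>_def min_le_iff_disj flip: pos_le_divide_eq)
    have d2: "\<delta> * K * (1 + cmod w) \<le> \<eta>"
    proof -
      have "\<delta> \<le> \<eta> / (K * (1 + cmod w))" by (simp add: \<delta>_def)
      then show ?thesis using K w1 by (simp add: pos_le_divide_eq mult.assoc)
    qed
    show "v \<in> Some ` ball w \<eta>"
    proof (cases v)
      case None
      then have "2 / K < \<delta>" using v by (simp add: sball_def K_def)
      then have "2 < \<delta> * K" using K by (simp add: field_simps)
      then show ?thesis using d1 by simp
    next
      case (Some u)
      define t where "t = cmod (w - u)"
      define M where "M = sqrt (1 + (cmod u)\<^sup>2)"
      have M: "M > 0" by (auto simp: M_def intro!: add_pos_nonneg)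
      have "M \<le> 1 + cmod u"
        unfolding M_def by (rule real_le_lsqrt) (auto simp: power2_eq_square algebra_simps)
      also have "cmod u \<le> cmod w + t" unfolding t_def by norm
      finally have MM: "M \<le> 1 + cmod w + t" by simp
      have "2 * t / (K * M) < \<delta>" using v by (simp add: Some sball_def K_def M_def t_def)
      then have "2 * t < \<delta> * (K * M)" using K M by (subst (asm) pos_divide_less_eq) auto
      also have "\<dots> = \<delta> * K * M" by simp
      also have "\<dots> \<le> \<delta> * K * (1 + cmod w + t)" using MM K \<open>\<delta> > 0\<close> by (intro mult_left_mono) auto
      also have "\<dots> = \<delta> * K * (1 + cmod w) + \<delta> * K * t" by (simp add: algebra_simps)
      also have "\<delta> * K * t \<le> 1 * t" using d1 by (intro mult_right_mono) (auto simp: t_def)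
      finally have "t < \<eta>" using d2 by simp
      then show ?thesis by (simp add: Some t_def dist_norm)
    qed
  qed
qed

lemma ball_subset_sball: "Some ` ball w (\<delta> / 2) \<subseteq> sball (Some w) \<delta>"
  using le_less_trans[OF chordal_le] by (fastforce simp: sball_def)

lemma sball_contains_ball:
  assumes "Some w \<in> sball (Some z) \<epsilon>"
  obtains \<eta> where "\<eta> > 0" "Some ` ball w \<eta> \<subseteq> sball (Some z) \<epsilon>"
proof -
  have "open {u. chordal (Some z) (Some u) < \<epsilon>}"
    unfolding chordal.simps
    by (intro open_Collect_less continuous_intros)
       (auto simp: add_nonneg_eq_0_iff dest: add_nonneg_eq_0_iff[THEN iffD1, rotated 2])
  moreover have "w \<in> {u. chordal (Some z) (Some u) < \<epsilon>}" using assms by (simp add: sball_def)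
  ultimately obtain \<eta> where "\<eta> > 0" "ball w \<eta> \<subseteq> {u. chordal (Some z) (Some u) < \<epsilon>}"
    using openE by blast
  then show thesis by (intro that[of \<eta>]) (auto simp: sball_def)
qed

lemma tendsto_chordal:
  assumes "(x \<longlongrightarrow> l) F"
  shows "((\<lambda>n. chordal (Some (x n)) (Some b)) \<longlongrightarrow> chordal (Some l) (Some b)) F"
proof -
  have pos: "sqrt (1 + (cmod t)\<^sup>2) > 0" for t by (auto intro!: add_pos_nonneg)
  show ?thesis unfolding chordal.simps
    using pos[of l] pos[of b] by (intro tendsto_intros assms) auto
qed

lemma chordal_eq_0_iff: "chordal (Some b) (Some c) = 0 \<longleftrightarrow> b = c"
proof -
  have pos: "sqrt (1 + (cmod t)\<^sup>2) > 0" for t by (auto intro!: add_pos_nonneg)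
  show ?thesis using pos[of b] pos[of c] by simp
qed

lemma chordal_limit_unique:
  assumes "x \<longlonglongrightarrow> l" "(\<lambda>n. chordal (Some (x n)) p) \<longlonglongrightarrow> 0"
  shows "p = Some l"
proof (cases p)
  case None
  have "(\<lambda>n. 2 / sqrt (1 + (cmod (x n))\<^sup>2)) \<longlonglongrightarrow> 2 / sqrt (1 + (cmod l)\<^sup>2)"
    using add_pos_nonneg[of 1 "(cmod l)\<^sup>2"] by (intro tendsto_intros assms) auto
  then have "2 / sqrt (1 + (cmod l)\<^sup>2) = 0"
    using assms(2) LIMSEQ_unique by (fastforce simp: None)
  then show ?thesis using add_pos_nonneg[of 1 "(cmod l)\<^sup>2"] by auto
next
  case (Some b)
  then have "chordal (Some l) (Some b) = 0"
    using tendsto_chordal[OF assms(1), of b] assms(2) LIMSEQ_unique by blast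
  then show ?thesis using Some by (simp only: chordal_eq_0_iff)
qed

text \<open>\<open>normal_family_on\<close> quantifies over arbitrary index sequences, which may
  repeat values. If no value is taken infinitely often, the sequence tends to infinity.\<close>

lemma nat_seq_subseq_cases:
  fixes s :: "nat \<Rightarrow> nat"
  obtains r :: "nat \<Rightarrow> nat" and v where "strict_mono r" "\<And>j. s (r j) = v"
  | "filterlim s at_top sequentially"
proof (cases "\<exists>v. infinite {n. s n = v}")
  case True
  then obtain v where v: "infinite {n. s n = v}" by blast
  show thesis
    using that(1)[of "enumerate {n. s n = v}" v] strict_mono_enumerate[OF v] enumerate_in_set[OF v] by auto
next
  case False
  have "finite {n. s n < B}" for B
  proof -
    have "{n. s n < B} = (\<Union>v<B. {n. s n = v})" by auto
    then show ?thesis using False by auto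
  qed
  then have "eventually (\<lambda>n. B \<le> s n) sequentially" for B
    unfolding eventually_sequentially
    by (metis (mono_tags, lifting) finite_nat_set_iff_bounded leI linorder_not_less mem_Collect_eq)
  then show thesis using that(2) by (simp add: filterlim_at_top)
qed

text \<open>For any \<open>\<kappa>\<close> strictly between \<open>norm D\<close> and 1, difference
  quotients near \<open>a\<close> stay below \<open>\<kappa>\<close>, so a small disc is contracted
  by that factor at every step.\<close>

lemma iterates_near_attracting_fixpoint:
  fixes f :: "complex \<Rightarrow> complex"
  assumes "(f has_field_derivative D) (at a)" "f a = a" "norm D < 1"
  obtains \<eta> \<kappa> where "\<eta> > 0" "0 < \<kappa>" "\<kappa> < 1"
    "\<And>n w. w \<in> ball a \<eta> \<Longrightarrow> dist ((f ^^ n) w) a \<le> \<kappa> ^ n * \<eta>"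
proof -
  obtain \<kappa> where \<kappa>: "norm D < \<kappa>" "\<kappa> < 1" using assms(3) dense by blast
  have \<kappa>0: "\<kappa> > 0" using \<kappa>(1) norm_ge_zero[of D] by linarith
  have "((\<lambda>w. (f w - f a) / (w - a)) \<longlongrightarrow> D) (at a)"
    using assms(1) by (simp add: has_field_derivative_iff)
  then have "eventually (\<lambda>w. norm ((f w - f a) / (w - a)) < \<kappa>) (at a)"
    using \<kappa>(1) by (intro order_tendstoD[OF tendsto_norm])
  then obtain \<eta> where \<eta>: "\<eta> > 0" "\<And>w. w \<noteq> a \<Longrightarrow> dist w a < \<eta> \<Longrightarrow> norm ((f w - f a) / (w - a)) < \<kappa>"
    unfolding eventually_at by blast
  have step: "dist (f w) a \<le> \<kappa> * dist w a" if "dist w a < \<eta>" for w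
  proof (cases "w = a")
    case False
    then have "norm (f w - a) / norm (w - a) < \<kappa>"
      using \<eta>(2)[OF False that] assms(2) by (simp add: norm_divide)
    then have "norm (f w - a) < \<kappa> * norm (w - a)" using False by (simp add: field_simps)
    then show ?thesis by (simp add: dist_norm)
  qed (simp add: assms(2))
  have "dist ((f ^^ n) w) a \<le> \<kappa> ^ n * dist w a" if w: "dist w a < \<eta>" for n w
  proof (induction n)
    case (Suc n)
    have "\<kappa> ^ n * dist w a \<le> 1 * dist w a"
      using \<kappa> \<kappa>0 by (intro mult_right_mono power_le_one) auto
    then have "dist ((f ^^ n) w) a < \<eta>" using Suc w by simp
    from step[OF this] have "dist ((f ^^ Suc n) w) a \<le> \<kappa> * dist ((f ^^ n) w) a" by simp
    also have "\<dots> \<le> \<kappa> * (\<kappa> ^ n * dist w a)" using Suc \<kappa>0 by simp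
    finally show ?case by simp
  qed simp
  then have "dist ((f ^^ n) w) a \<le> \<kappa> ^ n * \<eta>" if "w \<in> ball a \<eta>" for n w
    using that \<kappa>0 by (fastforce simp: dist_commute intro: order_trans mult_left_mono)
  then show thesis using that \<eta>(1) \<kappa>(2) \<kappa>0 by blast
qed

lemma repelling_fixpoint_expands:
  fixes f :: "complex \<Rightarrow> complex"
  assumes "(f has_field_derivative D) (at 0)" "f 0 = 0" "norm D > 1"
  obtains \<eta> \<kappa> where "\<eta> > 0" "\<kappa> > 1" "\<And>w. norm w < \<eta> \<Longrightarrow> \<kappa> * norm w \<le> norm (f w)"
proof -
  obtain \<kappa> where \<kappa>: "1 < \<kappa>" "\<kappa> < norm D" using assms(3) dense by blast
  have "((\<lambda>w. (f w - f 0) / (w - 0)) \<longlongrightarrow> D) (at 0)"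
    using assms(1) by (simp add: has_field_derivative_iff)
  then have "eventually (\<lambda>w. norm ((f w - f 0) / (w - 0)) > \<kappa>) (at 0)"
    using \<kappa>(2) by (intro order_tendstoD[OF tendsto_norm])
  then obtain \<eta> where \<eta>: "\<eta> > 0" "\<And>w. w \<noteq> 0 \<Longrightarrow> norm w < \<eta> \<Longrightarrow> norm (f w / w) > \<kappa>"
    unfolding eventually_at using assms(2) by auto
  have "\<kappa> * norm w \<le> norm (f w)" if "norm w < \<eta>" for w
    using \<eta>(2)[of w] that by (cases "w = 0") (auto simp: norm_divide field_simps)
  then show thesis using that \<eta>(1) \<kappa>(1) by blast
qed

section \<open>The basin of attraction and the Fatou set\<close>

lemma has_field_derivative_zeta:
  assumes "z \<noteq> -1"
  shows "(zeta lam has_field_derivative of_real lam * exp (- z) * (1 - z * (z + 1)) / (z + 1)\<^sup>2) (at z)"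
proof -
  have "z + 1 \<noteq> 0" using assms by (simp add: add_eq_0_iff2)
  then show ?thesis
    unfolding zeta_def by (auto intro!: derivative_eq_intros simp: field_simps power2_eq_square)
qed

lemma zeta_eq_0_iff: "lam \<noteq> 0 \<Longrightarrow> zeta lam z = 0 \<longleftrightarrow> z = 0 \<or> z = -1"
  by (auto simp: zeta_def add_eq_0_iff2)

lemma zeta_iter_eq_funpow:
  assumes "\<And>k. k < n \<Longrightarrow> (zeta lam ^^ k) z \<noteq> -1"
  shows "zeta_iter lam n (Some z) = Some (Some ((zeta lam ^^ n) z))"
  using assms by (induction n) auto

lemma orbit_avoids_pole:
  assumes "\<And>n. zeta_iter lam n (Some z) \<noteq> None"
  shows "(zeta lam ^^ n) z \<noteq> -1"
proof (induction n rule: less_induct)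
  case (less n)
  then have "zeta_iter lam n (Some z) = Some (Some ((zeta lam ^^ n) z))"
    by (intro zeta_iter_eq_funpow) auto
  \<comment> \<open>Two steps after -1: the first one gives infinity, which still counts as defined,
    and the second one fails.\<close>
  then show ?case using assms[of "Suc (Suc n)"] by auto
qed

text \<open>Division by zero makes the total function \<open>zeta lam\<close> send the pole to the
  fixed point 0. An orbit through the pole thus ends at 0 and cannot tend to
  \<open>a \<noteq> 0\<close>, so the total iterates give the same basin.\<close>

lemma basin_iff:
  assumes "a \<noteq> 0"
  shows "z \<in> basin lam a \<longleftrightarrow> (\<lambda>n. (zeta lam ^^ n) z) \<longlonglongrightarrow> a"
proof
  assume "z \<in> basin lam a"
  then obtain x where x: "\<And>n. zeta_iter lam n (Some z) = Some (Some (x n))" "x \<longlonglongrightarrow> a"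
    by (auto simp: basin_def)
  then have "x n = (zeta lam ^^ n) z" for n
    using zeta_iter_eq_funpow[of n lam z] orbit_avoids_pole[of lam z] by simp
  then show "(\<lambda>n. (zeta lam ^^ n) z) \<longlonglongrightarrow> a" using x(2) by presburger
next
  assume lim: "(\<lambda>n. (zeta lam ^^ n) z) \<longlonglongrightarrow> a"
  have "(zeta lam ^^ k) z \<noteq> -1" for k
  proof
    assume "(zeta lam ^^ k) z = -1"
    then have "(zeta lam ^^ (n + Suc k)) z = 0" for n
      by (induction n) (auto simp: zeta_def)
    then have "(\<lambda>n. 0) \<longlonglongrightarrow> a" using LIMSEQ_ignore_initial_segment[OF lim, of "Suc k"] by simp
    then show False using assms by (simp add: LIMSEQ_const_iff)
  qed
  then show "z \<in> basin lam a"
    unfolding basin_def using lim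
    by (auto intro!: exI[of _ "\<lambda>n. (zeta lam ^^ n) z"] zeta_iter_eq_funpow)
qed

lemma funpow_zeta_in_basin_iff:
  assumes "a \<noteq> 0"
  shows "(zeta lam ^^ n) z \<in> basin lam a \<longleftrightarrow> z \<in> basin lam a"
proof -
  have "(\<lambda>m. (zeta lam ^^ m) ((zeta lam ^^ n) z)) = (\<lambda>m. (zeta lam ^^ (m + n)) z)"
    by (simp add: funpow_add)
  then show ?thesis
    unfolding basin_iff[OF assms]
    using LIMSEQ_ignore_initial_segment[of "\<lambda>m. (zeta lam ^^ m) z" a n] LIMSEQ_offset[of "\<lambda>m. (zeta lam ^^ m) z" n a]
    by metis
qed

lemma orbit_in_basin_avoids_pole:
  assumes "z \<in> basin lam a"
  shows "(zeta lam ^^ n) z \<noteq> -1"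
  using assms by (intro orbit_avoids_pole) (auto simp: basin_def)

lemma isCont_funpow_zeta:
  assumes "\<And>k. k < n \<Longrightarrow> (zeta lam ^^ k) z \<noteq> -1"
  shows "isCont (zeta lam ^^ n) z"
  using assms
proof (induction n)
  case (Suc n)
  have "isCont (zeta lam) ((zeta lam ^^ n) z)"
    using has_field_derivative_zeta[OF Suc.prems[of n]] by (auto intro: DERIV_isCont)
  then show ?case using isCont_o2[OF Suc.IH] Suc.prems by simp
qed (simp add: id_def)

lemma holomorphic_funpow_zeta:
  assumes "open S" "\<And>w k. w \<in> S \<Longrightarrow> (zeta lam ^^ k) w \<noteq> -1"
  shows "(zeta lam ^^ n) holomorphic_on S"
proof (induction n)
  case 0
  then show ?case by (simp add: id_def)
next
  case (Suc n)
  have "zeta lam holomorphic_on - {-1}"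
    using has_field_derivative_zeta[of _ lam] by (subst holomorphic_on_open) auto
  moreover have "(zeta lam ^^ n) ` S \<subseteq> - {-1}" using assms(2) by (auto simp del: funpow.simps dest: sym)
  ultimately show ?case unfolding funpow.simps using holomorphic_on_compose_gen[OF Suc] by blast
qed

section \<open>The attracting fixed point and its basin\<close>

locale attracting_zeta =
  fixes lam a :: real
  assumes lam: "1 < lam" "lam < lamstar" and a_nz: "a \<noteq> 0"
    and fixpoint: "zeta lam (of_real a) = of_real a"
begin

abbreviation "f \<equiv> zeta lam"
abbreviation "A \<equiv> basin lam (of_real a)"

lemma rzeta_fixpoint: "rzeta lam a = a"
  using fixpoint by (simp only: zeta_of_real of_real_eq_iff)

text \<open>Dividing the fixed point equation by \<open>a\<close> gives the formula for
  \<open>lam\<close>. Positivity follows from \<open>lam \<le> exp (a + a)\<close>, the upper bound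
  from monotonicity of \<open>(a + 1) * exp a\<close>.\<close>

lemma lam_eq: "lam = (a + 1) * exp a" and a_pos: "a > 0" and a_less: "a < sqrt 2"
proof -
  \<comment> \<open>At -1 division by zero gives \<open>rzeta\<close> the value 0, so -1 is not a
    fixed point.\<close>
  have "a + 1 \<noteq> 0" using rzeta_fixpoint a_nz by (auto simp: rzeta_def)
  then have "a * lam = a * ((a + 1) * exp a)"
    using rzeta_fixpoint by (simp add: rzeta_def exp_minus divide_simps mult_ac)
  then show eq: "lam = (a + 1) * exp a" using a_nz by simp
  have "lam \<le> exp a * exp a"
    unfolding eq using exp_ge_add_one_self[of a] by (intro mult_right_mono) (auto simp: add.commute)
  also have "exp a * exp a = exp (a + a)" by (simp only: exp_add)
  finally have "1 < exp (a + a)" using lam by linarith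
  then have "0 < a + a" by (simp only: one_less_exp_iff)
  then show "a > 0" by simp
  show "a < sqrt 2"
  proof (rule ccontr)
    assume "\<not> a < sqrt 2"
    then have "lamstar \<le> (a + 1) * exp a" using \<open>a > 0\<close> by (intro mult_mono) auto
    then show False using lam eq by simp
  qed
qed

text \<open>Inserting \<open>lam_eq\<close>, the multiplier is
  \<open>(1 - a * (a + 1)) / (a + 1)\<close>; given \<open>a > 0\<close>, its modulus is below 1
  exactly when \<open>a * a < 2\<close>.\<close>

lemma iterates_near_fixpoint:
  obtains \<eta> \<kappa> where "\<eta> > 0" "0 < \<kappa>" "\<kappa> < 1"
    "\<And>n w. w \<in> ball (of_real a) \<eta> \<Longrightarrow> dist ((f ^^ n) w) (of_real a) \<le> \<kappa> ^ n * \<eta>"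
proof (rule iterates_near_attracting_fixpoint)
  have "complex_of_real a \<noteq> - 1" using a_pos by (auto simp: complex_eq_iff)
  then show "(f has_field_derivative of_real lam * exp (- of_real a) * (1 - of_real a * (of_real a + 1)) / (of_real a + 1)\<^sup>2) (at (of_real a))"
    by (rule has_field_derivative_zeta)
  have "of_real lam * exp (- of_real a) * (1 - of_real a * (of_real a + 1)) / (of_real a + 1)\<^sup>2
      = complex_of_real (lam * exp (- a) * (1 - a * (a + 1)) / (a + 1)\<^sup>2)"
    by (simp add: exp_of_real flip: of_real_minus)
  also have "lam * exp (- a) * (1 - a * (a + 1)) / (a + 1)\<^sup>2 = (1 - a * (a + 1)) / (a + 1)"
    using a_pos unfolding lam_eq by (simp add: exp_minus divide_simps power2_eq_square)
  finally have D: "norm (of_real lam * exp (- of_real a) * (1 - of_real a * (of_real a + 1)) / (of_real a + 1)\<^sup>2 :: complex)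
     = \<bar>(1 - a * (a + 1)) / (a + 1)\<bar>" by (simp only: norm_of_real)
  have "a * a < 2"
    using a_pos a_less mult_strict_mono[of a "sqrt 2" a "sqrt 2"] by simp
  then have "\<bar>1 - a * (a + 1)\<bar> < a + 1" using a_pos by (simp add: abs_less_iff algebra_simps add_pos_pos)
  then show "norm (of_real lam * exp (- of_real a) * (1 - of_real a * (of_real a + 1)) / (of_real a + 1)\<^sup>2 :: complex) < 1"
    unfolding D using a_pos by (simp add: abs_divide)
qed (use fixpoint in auto)

text \<open>The orbit of \<open>z\<close> enters the contracted disc at some time \<open>N\<close>,
  and by continuity of \<open>f ^^ N\<close> so do all nearby orbits. The uniform rate serves both
  openness of the basin and normality.\<close>

lemma basin_nbhd:
  assumes "z \<in> A"
  obtains \<epsilon> N \<kappa> C where "\<epsilon> > 0" "0 < \<kappa>" "\<kappa> < 1"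
    "\<And>n w. w \<in> ball z \<epsilon> \<Longrightarrow> dist ((f ^^ (n + N)) w) (of_real a) \<le> \<kappa> ^ n * C"
proof -
  obtain \<eta> \<kappa> where \<eta>: "\<eta> > 0" "0 < \<kappa>" "\<kappa> < 1"
    "\<And>n w. w \<in> ball (of_real a) \<eta> \<Longrightarrow> dist ((f ^^ n) w) (of_real a) \<le> \<kappa> ^ n * \<eta>"
    using iterates_near_fixpoint by blast
  have "(\<lambda>n. (f ^^ n) z) \<longlonglongrightarrow> of_real a" using assms a_nz by (simp add: basin_iff)
  then obtain N where N: "dist ((f ^^ N) z) (of_real a) < \<eta>"
    using \<eta>(1) by (meson LIMSEQ_def le_refl metric_LIMSEQ_D)
  have "isCont (f ^^ N) z"
    using assms a_nz by (intro isCont_funpow_zeta orbit_in_basin_avoids_pole) auto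
  then have "((f ^^ N) \<longlongrightarrow> (f ^^ N) z) (nhds z)" by (simp add: isCont_def tendsto_at_iff_tendsto_nhds)
  then have "eventually (\<lambda>w. dist ((f ^^ N) w) (of_real a) < \<eta>) (nhds z)"
    using N by (intro order_tendstoD[OF tendsto_dist[OF _ tendsto_const]])
  then obtain \<epsilon> where \<epsilon>: "\<epsilon> > 0" "\<And>w. dist w z < \<epsilon> \<Longrightarrow> dist ((f ^^ N) w) (of_real a) < \<eta>"
    unfolding eventually_nhds_metric by blast
  have "dist ((f ^^ (n + N)) w) (of_real a) \<le> \<kappa> ^ n * \<eta>" if "w \<in> ball z \<epsilon>" for n w
    using \<eta>(4)[of "(f ^^ N) w" n] \<epsilon>(2)[of w] that by (simp add: funpow_add dist_commute)
  then show thesis using that \<epsilon>(1) \<eta>(2,3) by blast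
qed

lemma open_basin: "open A"
proof (rule openI)
  fix z assume z: "z \<in> A"
  obtain \<epsilon> N \<kappa> C where \<epsilon>: "\<epsilon> > 0" "0 < \<kappa>" "\<kappa> < 1"
    "\<And>n w. w \<in> ball z \<epsilon> \<Longrightarrow> dist ((f ^^ (n + N)) w) (of_real a) \<le> \<kappa> ^ n * C"
    by (rule basin_nbhd[OF z], rule that)
  have "w \<in> A" if w: "w \<in> ball z \<epsilon>" for w
  proof -
    have "(\<lambda>n. \<kappa> ^ n * C) \<longlonglongrightarrow> 0"
      using \<epsilon>(2,3) by (intro tendsto_mult_left_zero LIMSEQ_power_zero) auto
    then have "(\<lambda>n. dist ((f ^^ (n + N)) w) (of_real a)) \<longlonglongrightarrow> 0"
      by (rule Lim_null_comparison[rotated]) (use \<epsilon>(4)[OF w] in auto)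
    then have "(\<lambda>n. (f ^^ (n + N)) w) \<longlonglongrightarrow> of_real a"
      by (subst tendsto_dist_iff)
    then show ?thesis using a_nz LIMSEQ_offset[of "\<lambda>n. (f ^^ n) w" N] by (simp add: basin_iff)
  qed
  then show "\<exists>e>0. ball z e \<subseteq> A" using \<epsilon>(1) by blast
qed

lemma pos_real_in_basin:
  assumes "x > 0"
  shows "of_real x \<in> A"
proof -
  have "(f ^^ n) (of_real x) = of_real ((rzeta lam ^^ n) x)" for n
    by (induction n) (auto simp: zeta_of_real)
  moreover have "(\<lambda>n. (rzeta lam ^^ n) x) \<longlonglongrightarrow> a"
    using lam a_pos rzeta_fixpoint assms by (intro rzeta_iterates_tendsto) auto
  ultimately show ?thesis using a_nz by (simp add: basin_iff tendsto_of_real)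
qed

text \<open>An index sequence tending to infinity gives uniform convergence to \<open>a\<close>;
  otherwise some subsequence is constant, and the limit is that single iterate.\<close>

lemma basin_in_fatou:
  assumes "z \<in> A"
  shows "Some z \<in> fatou_set lam"
proof -
  obtain \<epsilon>0 N \<kappa> C where e0: "\<epsilon>0 > 0" and \<kappa>: "0 < \<kappa>" "\<kappa> < 1"
    and bound: "\<And>n w. w \<in> ball z \<epsilon>0 \<Longrightarrow> dist ((f ^^ (n + N)) w) (of_real a) \<le> \<kappa> ^ n * C"
    by (rule basin_nbhd[OF assms], rule that)
  obtain \<epsilon>1 where e1: "\<epsilon>1 > 0" "ball z \<epsilon>1 \<subseteq> A" using open_basin assms openE by blast
  obtain \<delta> where \<delta>: "\<delta> > 0" "sball (Some z) \<delta> \<subseteq> Some ` ball z (min \<epsilon>0 \<epsilon>1)"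
    using sball_subset_ball[of "min \<epsilon>0 \<epsilon>1"] e0 e1 by auto
  define F where "F = (\<lambda>n w. the (zeta_iter lam n w))"
  have finite_iter: "zeta_iter lam n (Some w) = Some (Some ((f ^^ n) w))" if "w \<in> A" for n w
    using that a_nz by (intro zeta_iter_eq_funpow orbit_in_basin_avoids_pole) auto
  have pt: "\<exists>u. v = Some u \<and> u \<in> A \<and> u \<in> ball z \<epsilon>0" if v: "v \<in> sball (Some z) \<delta>" for v
  proof -
    obtain u where "v = Some u" "u \<in> ball z (min \<epsilon>0 \<epsilon>1)" using v \<delta>(2) by blast
    then show ?thesis using e1(2) by auto
  qed
  \<comment> \<open>Chordal discs are open: the smaller disc is found by passing to a Euclidean disc
    and back.\<close>
  have small: "\<exists>\<delta>'>0. sball w \<delta>' \<subseteq> sball (Some z) \<delta>" if w: "w \<in> sball (Some z) \<delta>" for w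
  proof -
    obtain u where u: "w = Some u" using pt[OF w] by blast
    then obtain \<eta> where "\<eta> > 0" "Some ` ball u \<eta> \<subseteq> sball (Some z) \<delta>"
      using sball_contains_ball w by blast
    moreover obtain \<delta>' where "\<delta>' > 0" "sball (Some u) \<delta>' \<subseteq> Some ` ball u \<eta>"
      using sball_subset_ball[OF \<open>\<eta> > 0\<close>] by blast
    ultimately show ?thesis using u by blast
  qed
  have "\<exists>r g. strict_mono r \<and> (\<forall>w\<in>sball (Some z) \<delta>. \<exists>\<delta>'>0. sball w \<delta>' \<subseteq> sball (Some z) \<delta> \<and>
          (\<forall>e>0. \<forall>\<^sub>F j in sequentially. \<forall>u\<in>sball w \<delta>'. chordal (F (s (r j)) u) (g u) < e))" for s :: "nat \<Rightarrow> nat"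
  proof -
    have "\<exists>(r :: nat \<Rightarrow> nat) g. strict_mono r \<and>
        (\<forall>e>0. \<forall>\<^sub>F j in sequentially. \<forall>u\<in>sball (Some z) \<delta>. chordal (F (s (r j)) u) (g u) < e)"
    proof (rule nat_seq_subseq_cases[of s])
      fix r :: "nat \<Rightarrow> nat" and v assume r: "strict_mono r" "\<And>j. s (r j) = v"
      have "chordal p p = 0" for p by (cases p) auto
      then show ?thesis using r by (intro exI[of _ r] exI[of _ "F v"]) auto
    next
      assume s: "filterlim s at_top sequentially"
      have "\<forall>\<^sub>F j in sequentially. \<forall>u\<in>sball (Some z) \<delta>. chordal (F (s (id j)) u) (Some (of_real a)) < e" if "e > 0" for e
      proof -
        have "(\<lambda>n. \<kappa> ^ n * C) \<longlonglongrightarrow> 0"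
          using \<kappa> by (intro tendsto_mult_left_zero LIMSEQ_power_zero) auto
        then have "\<forall>\<^sub>F n in sequentially. \<kappa> ^ n * C < e / 2"
          using that by (intro order_tendstoD) auto
        then obtain M where M: "\<And>n. n \<ge> M \<Longrightarrow> \<kappa> ^ n * C < e / 2"
          unfolding eventually_sequentially by blast
        have "\<forall>\<^sub>F j in sequentially. s j \<ge> M + N" using s by (simp add: filterlim_at_top)
        then show ?thesis
        proof eventually_elim
          case (elim j)
          show ?case
          proof
            fix v assume "v \<in> sball (Some z) \<delta>"
            then obtain u where u: "v = Some u" "u \<in> A" "u \<in> ball z \<epsilon>0" using pt by blast
            have "chordal (F (s (id j)) v) (Some (of_real a)) \<le> 2 * dist ((f ^^ (s j)) u) (of_real a)"
              using chordal_le u by (simp only: F_def finite_iter option.sel id_apply)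
            also have "\<dots> \<le> 2 * (\<kappa> ^ (s j - N) * C)" using bound[OF u(3), of "s j - N"] elim by simp
            also have "\<dots> < e" using M[of "s j - N"] elim by linarith
            finally show "chordal (F (s (id j)) v) (Some (of_real a)) < e" .
          qed
        qed
      qed
      then show ?thesis by (intro exI[of _ id] exI[of _ "\<lambda>_. Some (of_real a)"]) (auto simp: strict_mono_def)
    qed
    then obtain r g where rg: "strict_mono (r :: nat \<Rightarrow> nat)"
      "\<And>e. e > 0 \<Longrightarrow> \<forall>\<^sub>F j in sequentially. \<forall>u\<in>sball (Some z) \<delta>. chordal (F (s (r j)) u) (g u) < e" by blast
    show ?thesis
    proof (intro exI[of _ r] exI[of _ g] conjI rg(1) ballI)
      fix w assume "w \<in> sball (Some z) \<delta>"
      then obtain \<delta>' where d': "\<delta>' > 0" "sball w \<delta>' \<subseteq> sball (Some z) \<delta>" using small by blast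
      have "\<forall>\<^sub>F j in sequentially. \<forall>u\<in>sball w \<delta>'. chordal (F (s (r j)) u) (g u) < e" if "e > 0" for e
        using rg(2)[OF that] by eventually_elim (use d' in blast)
      then show "\<exists>\<delta>'>0. sball w \<delta>' \<subseteq> sball (Some z) \<delta> \<and>
          (\<forall>e>0. \<forall>\<^sub>F j in sequentially. \<forall>u\<in>sball w \<delta>'. chordal (F (s (r j)) u) (g u) < e)"
        using d' by blast
    qed
  qed
  then have "normal_family_on F (sball (Some z) \<delta>)" unfolding normal_family_on_def by blast
  moreover have "zeta_iter lam n w \<noteq> None" if "w \<in> sball (Some z) \<delta>" for n w
    using pt[OF that] finite_iter by auto
  ultimately show ?thesis
    unfolding fatou_set_def F_def using \<delta>(1) by blast
qed

text \<open>The factor by which \<open>f\<close> stretches the hyperbolic metric of the slit plane: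
  the derivative has modulus \<open>cmod (f w) * cmod (zeta_elast w) / cmod w\<close>, and the
  moduli cancel against those in the two densities.\<close>

definition expansion :: "complex \<Rightarrow> real" where
  "expansion w = cmod (zeta_elast w) * half_sine w / half_sine (f w)"

lemma expansion_gt_1:
  assumes "w \<notin> \<real>\<^sub>\<ge>\<^sub>0" "w \<noteq> -1" "f w \<notin> \<real>\<^sub>\<ge>\<^sub>0"
  shows "expansion w > 1"
  unfolding expansion_def using half_sine_zeta_less[OF _ assms] half_sine_pos[OF assms(3)] lam
  by simp

lemma expansion_ge:
  assumes "f w \<notin> \<real>\<^sub>\<ge>\<^sub>0"
  shows "cmod (zeta_elast w) * half_sine w \<le> expansion w"
proof -
  have "cmod (zeta_elast w) * half_sine w / 1 \<le> expansion w"
    unfolding expansion_def using half_sine_pos[OF assms] half_sine_bounds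
    by (intro divide_left_mono mult_nonneg_nonneg) auto
  then show ?thesis by simp
qed

text \<open>The term \<open>1 / (w + 1)\<close> dominates \<open>zeta_elast\<close>, and the
  negative real part keeps \<open>half_sine w\<close> at least 1/2. Any bound above 1 would serve in
  place of 2.\<close>

lemma expansion_near_pole:
  assumes "w \<noteq> -1" "cmod (w + 1) < 1 / 10" "f w \<notin> \<real>\<^sub>\<ge>\<^sub>0"
  shows "expansion w > 2"
proof -
  define t where "t = cmod (w + 1)"
  have t: "0 < t" "t < 1 / 10" using assms by (auto simp: t_def add_eq_0_iff2)
  have "\<bar>Re (w + 1)\<bar> \<le> t" unfolding t_def by (rule abs_Re_le_cmod)
  then have "Re w < 0" using t by simp
  then have "Re w \<le> cmod w / 2" "w \<noteq> 0" using norm_ge_zero[of w] by (linarith, auto)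
  then have S: "half_sine w \<ge> 1 / 2" by (rule half_sine_ge_half)
  have "cmod w \<le> 1 + t" unfolding t_def using norm_triangle_ineq4[of "w + 1" 1] by simp
  moreover have "1 / t > 10" using t by (simp add: field_simps)
  moreover have "1 / t - cmod w \<le> cmod (zeta_elast w)"
    using norm_triangle_ineq2[of "1 / (w + 1)" w]
    by (simp add: zeta_elast_def t_def norm_divide norm_minus_commute)
  ultimately have "cmod (zeta_elast w) > 8" using t by linarith
  then have "8 * (1 / 2) \<le> cmod (zeta_elast w) * half_sine w"
    using S by (intro mult_mono) auto
  then show ?thesis using expansion_ge[OF assms(3)] by simp
qed

text \<open>Here \<open>w\<close> dominates \<open>zeta_elast\<close>. The condition on the
  direction keeps \<open>half_sine w\<close> away from 0.\<close>

lemma expansion_near_infinity: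
  assumes "cmod w > 6" "Re w \<le> cmod w / 2" "f w \<notin> \<real>\<^sub>\<ge>\<^sub>0"
  shows "expansion w > 2"
proof -
  have S: "half_sine w \<ge> 1 / 2" using assms by (intro half_sine_ge_half) auto
  have "cmod (w + 1) \<ge> 5" using norm_triangle_ineq2[of w "-1"] assms by simp
  then have "cmod (1 / (w + 1)) \<le> 1" by (simp add: norm_divide divide_simps)
  then have "cmod (zeta_elast w) > 5"
    unfolding zeta_elast_def using norm_triangle_ineq2[of w "1 / (w + 1)"] assms by linarith
  then have "5 * (1 / 2) \<le> cmod (zeta_elast w) * half_sine w"
    using S by (intro mult_mono) auto
  then show ?thesis using expansion_ge[OF assms(3)] by simp
qed

text \<open>This covers the directions near the positive axis left open by
  \<open>expansion_near_infinity\<close>: there a far point returns to a bounded set at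
  once.\<close>

lemma norm_zeta_le:
  assumes "Re w > 0"
  shows "cmod (f w) \<le> lam"
proof -
  have "(cmod w)\<^sup>2 \<le> (cmod (w + 1))\<^sup>2" unfolding cmod_power2 using assms by (simp add: power2_eq_square algebra_simps)
  then have "cmod w \<le> cmod (w + 1)" by (rule power2_le_imp_le) simp
  then have "cmod w / cmod (w + 1) \<le> 1" by (simp add: divide_le_eq_1)
  moreover have "exp (- Re w) \<le> 1" using assms by simp
  ultimately have "cmod w / cmod (w + 1) * exp (- Re w) \<le> 1 * 1" by (intro mult_mono) auto
  moreover have "cmod (f w) = lam * (cmod w / cmod (w + 1) * exp (- Re w))"
    using lam by (simp add: zeta_def norm_mult norm_divide)
  ultimately show ?thesis using lam mult_left_mono[of _ 1 lam] by fastforce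
qed

text \<open>The contradiction that makes the basin dense: the hyperbolic derivatives
  \<open>D n\<close> increase and are bounded, so their ratios tend to 1, although the orbit has a
  cluster point at which expansion is strict.\<close>

lemma no_basin_free_disc:
  assumes r: "r > 0" and avoid: "\<And>w n. w \<in> ball z r \<Longrightarrow> (f ^^ n) w \<noteq> -1"
    and disj: "ball z r \<inter> A = {}"
  shows False
proof -
  define X where "X = (\<lambda>n. (f ^^ n) z)"
  have X_Suc: "X (Suc n) = f (X n)" for n by (simp add: X_def)
  have zr: "z \<in> ball z r" using r by simp
  have notA: "(f ^^ n) w \<notin> A" if "w \<in> ball z r" for w n
    using that disj a_nz funpow_zeta_in_basin_iff[where a = "of_real a" and n = n and z = w] by auto
  \<comment> \<open>The zeros of the total function \<open>f\<close> are 0 and, through division by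
    zero, -1; \<open>avoid\<close> rules out -1, so 0 is reached only from 0.\<close>
  have zero: "w = 0" if "w \<in> ball z r" "(f ^^ n) w = 0" for w n
    using that(2)
  proof (induction n)
    case (Suc n)
    then show ?case using avoid[OF that(1), of n] lam by (auto simp: zeta_eq_0_iff)
  qed simp
  have "0 \<notin> ball z r"
  proof
    assume "0 \<in> ball z r"
    then obtain e where e: "e > 0" "ball 0 e \<subseteq> ball z r" using openE[OF open_ball] by blast
    then have "complex_of_real (e / 2) \<in> ball z r" by (intro subsetD[OF e(2)]) (auto simp: dist_norm)
    then show False using pos_real_in_basin[of "e / 2"] disj e by auto
  qed
  then have slit: "(f ^^ n) w \<notin> \<real>\<^sub>\<ge>\<^sub>0" if "w \<in> ball z r" for w n
    using notA[OF that, of n] zero[OF that, of n] pos_real_in_basin[of "Re ((f ^^ n) w)"] that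
    by (metis complex_is_Real_iff complex_nonneg_Reals_iff less_eq_real_def of_real_0 of_real_Re)
  have Xslit: "X n \<notin> \<real>\<^sub>\<ge>\<^sub>0" and XA: "X n \<notin> A" and X1: "X n \<noteq> -1" for n
    using slit[OF zr] notA[OF zr] avoid[OF zr] by (auto simp: X_def)
  have X0: "X n \<noteq> 0" for n using Xslit[of n] by auto
  \<comment> \<open>Twice the slit-plane density at \<open>X n\<close> times the modulus of the
    derivative of \<open>f ^^ n\<close> at \<open>z\<close>.\<close>
  define D where "D = (\<lambda>n. cmod (deriv (f ^^ n) z) / (cmod (X n) * half_sine (X n)))"
  have den: "cmod (X n) * half_sine (X n) > 0" for n
    using X0[of n] half_sine_pos[OF Xslit[of n]] by simp
  have hol: "(f ^^ n) holomorphic_on ball z r" for n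
    using avoid by (intro holomorphic_funpow_zeta) auto
  have D_le: "D n \<le> 4 / r" for n
    using slit_plane_deriv_bound[OF r hol slit, of n] den[of n]
    by (simp add: D_def X_def pos_divide_le_eq)
  have D_Suc: "D (Suc n) = D n * expansion (X n)" for n
  proof -
    have X1': "X n + 1 \<noteq> 0" using X1[of n] by (simp add: add_eq_0_iff2)
    have "((f ^^ n) has_field_derivative deriv (f ^^ n) z) (at z)"
      using holomorphic_derivI[OF hol _ zr] by simp
    moreover have "(f has_field_derivative - (f (X n) * zeta_elast (X n) / X n)) (at ((f ^^ n) z))"
    proof -
      have "of_real lam * exp (- X n) * (1 - X n * (X n + 1)) / (X n + 1)\<^sup>2 = - (f (X n) * zeta_elast (X n) / X n)"
      proof -
        have Q: "zeta_elast (X n) = - ((1 - X n * (X n + 1)) / (X n + 1))"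
          using X1' by (simp add: zeta_elast_def field_simps)
        have "f (X n) / X n = of_real lam * exp (- X n) / (X n + 1)"
          using X0[of n] by (simp add: zeta_def)
        then have "- (f (X n) * zeta_elast (X n) / X n) = of_real lam * exp (- X n) / (X n + 1) * - zeta_elast (X n)"
          by (metis mult_minus_right times_divide_eq_left)
        then show ?thesis unfolding Q by (simp add: power2_eq_square)
      qed
      then show ?thesis using has_field_derivative_zeta[OF X1[of n], of lam] by (simp add: X_def)
    qed
    ultimately have "((\<lambda>w. f ((f ^^ n) w)) has_field_derivative
        - (f (X n) * zeta_elast (X n) / X n) * deriv (f ^^ n) z) (at z)"
      by (rule DERIV_chain2[rotated])
    then have "deriv (f ^^ Suc n) z = - (f (X n) * zeta_elast (X n) / X n) * deriv (f ^^ n) z"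
      by (simp add: DERIV_imp_deriv o_def)
    then have "cmod (deriv (f ^^ Suc n) z) = cmod (f (X n)) * cmod (zeta_elast (X n)) / cmod (X n) * cmod (deriv (f ^^ n) z)"
      by (simp add: norm_mult norm_divide)
    then show ?thesis
      unfolding D_def expansion_def X_Suc using X0[of n] X0[of "Suc n"] half_sine_pos[OF Xslit[of n]] by (simp add: X_Suc)
  qed
  have E1: "expansion (X n) > 1" for n
    using expansion_gt_1[OF Xslit X1, of n] Xslit[of "Suc n"] by (simp add: X_Suc)
  have D0: "D 0 > 0"
    using den[of 0] by (simp add: D_def id_def[symmetric])
  have Dpos: "D n > 0" for n
    by (induction n) (use D0 E1 in \<open>auto simp: D_Suc intro!: mult_pos_pos intro: less_trans[OF zero_less_one]\<close>)
  have "incseq D"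
    using E1 Dpos by (intro incseq_SucI) (auto simp: D_Suc less_imp_le)
  then obtain L where L: "D \<longlonglongrightarrow> L" "\<And>n. D n \<le> L"
    using incseq_convergent[of D "4 / r"] D_le by metis
  have L0: "L > 0" using L(2)[of 0] D0 by simp
  have "(\<lambda>n. D (Suc n) / D n) \<longlonglongrightarrow> L / L"
    using L0 by (intro tendsto_divide LIMSEQ_Suc L) auto
  moreover have "D (Suc n) / D n = expansion (X n)" for n
    using Dpos[of n] by (simp add: D_Suc)
  ultimately have E_lim: "(\<lambda>n. expansion (X n)) \<longlonglongrightarrow> 1" using L0 by simp
  then have "\<forall>\<^sub>F n in sequentially. expansion (X n) < 2" by (rule order_tendstoD) simp
  then obtain N where N: "\<And>n. n \<ge> N \<Longrightarrow> expansion (X n) < 2"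
    unfolding eventually_sequentially by blast
  have fXslit: "f (X n) \<notin> \<real>\<^sub>\<ge>\<^sub>0" for n using Xslit[of "Suc n"] by (simp add: X_Suc)
  have far_pole: "cmod (X n + 1) \<ge> 1 / 10" if "n \<ge> N" for n
    using expansion_near_pole[OF X1 _ fXslit, of n] N[OF that] by fastforce
  \<comment> \<open>6 is the threshold of \<open>expansion_near_infinity\<close> and
    \<open>lam\<close> the bound of \<open>norm_zeta_le\<close>: a late point outside radius
    \<open>R\<close> is followed by one inside.\<close>
  define R where "R = max 6 lam"
  have far: "cmod (X (Suc n)) \<le> R" if "n \<ge> N" "cmod (X n) > R" for n
  proof -
    have "Re (X n) > cmod (X n) / 2"
      using expansion_near_infinity[OF _ _ fXslit, of n] N[OF that(1)] that(2) by (fastforce simp: R_def)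
    then have "Re (X n) > 0" using norm_ge_zero[of "X n"] by linarith
    then show ?thesis using norm_zeta_le[of "X n"] by (simp add: X_Suc R_def)
  qed
  have der0: "(f has_field_derivative of_real lam) (at 0)"
    using has_field_derivative_zeta[of 0 lam] by simp
  have f0: "f 0 = 0" by (simp add: zeta_def)
  obtain \<eta> \<kappa> where \<eta>: "\<eta> > 0" "\<kappa> > 1" "\<And>w. norm w < \<eta> \<Longrightarrow> \<kappa> * norm w \<le> norm (f w)"
    using repelling_fixpoint_expands[OF der0 f0] lam by auto
  have "(f \<longlongrightarrow> f 0) (nhds 0)"
    using DERIV_isCont[OF der0] by (simp add: isCont_def tendsto_at_iff_tendsto_nhds)
  then have "\<forall>\<^sub>F w in nhds 0. cmod (f w) < R"
    by (intro order_tendstoD[OF tendsto_norm]) (auto simp: f0 R_def)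
  then obtain \<eta>' where \<eta>': "\<eta>' > 0" "\<And>w. cmod w < \<eta>' \<Longrightarrow> cmod (f w) < R"
    unfolding eventually_nhds_metric by auto
  define \<epsilon> where "\<epsilon> = min \<eta> \<eta>'"
  have \<epsilon>: "\<epsilon> > 0" using \<eta> \<eta>' by (simp add: \<epsilon>_def)
  have escape: "\<exists>k. cmod (X (n + k)) \<ge> \<epsilon>" for n
  proof (rule ccontr)
    assume "\<nexists>k. cmod (X (n + k)) \<ge> \<epsilon>"
    then have small: "cmod (X (n + k)) < \<epsilon>" for k by (simp add: not_le)
    have grow: "\<kappa> ^ k * cmod (X n) \<le> cmod (X (n + k))" for k
    proof (induction k)
      case (Suc k)
      have "\<kappa> ^ Suc k * cmod (X n) \<le> \<kappa> * cmod (X (n + k))" using Suc \<eta>(2) by simp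
      also have "\<dots> \<le> cmod (f (X (n + k)))" using \<eta>(3) small[of k] by (simp add: \<epsilon>_def)
      finally show ?case by (simp add: X_Suc)
    qed simp
    obtain k where "\<epsilon> / cmod (X n) < \<kappa> ^ k" using real_arch_pow[OF \<eta>(2)] by blast
    then have "\<epsilon> < \<kappa> ^ k * cmod (X n)" using X0[of n] by (simp add: field_simps)
    then show False using grow[of k] small[of k] by linarith
  qed
  have "\<exists>n\<ge>M. \<epsilon> \<le> cmod (X n) \<and> cmod (X n) \<le> R" for M
  proof -
    obtain n where n: "n \<ge> M" "cmod (X n) \<le> R"
    proof (cases "cmod (X (max M N)) \<le> R")
      case True
      then show thesis using that[of "max M N"] by simp
    next
      case False
      then show thesis using that[of "Suc (max M N)"] far[of "max M N"] by simp
    qed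
    \<comment> \<open>The first time at modulus at least \<open>\<epsilon>\<close>. The point before
      it, if \<open>k > 0\<close>, is within \<open>\<eta>'\<close> of 0, so this step cannot jump
      beyond \<open>R\<close>.\<close>
    define k where "k = (LEAST k. cmod (X (n + k)) \<ge> \<epsilon>)"
    have k: "cmod (X (n + k)) \<ge> \<epsilon>" unfolding k_def by (rule LeastI_ex[OF escape])
    have "cmod (X (n + k)) \<le> R"
    proof (cases k)
      case 0
      then show ?thesis using n by simp
    next
      case (Suc j)
      then have "cmod (X (n + j)) < \<epsilon>"
        using not_less_Least[of j "\<lambda>k. cmod (X (n + k)) \<ge> \<epsilon>"] unfolding k_def by fastforce
      then show ?thesis using \<eta>'(2)[of "X (n + j)"] Suc by (simp add: X_Suc \<epsilon>_def)
    qed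
    then show ?thesis using k n by (intro exI[of _ "n + k"]) auto
  qed
  then obtain t where t: "\<And>j. t j \<ge> j" "\<And>j. X (t j) \<in> cball 0 R - ball 0 \<epsilon>"
    by (metis (no_types, lifting) DiffI dist_0_norm mem_ball mem_cball not_le)
  have "compact (cball (0::complex) R - ball 0 \<epsilon>)" by (intro compact_diff) auto
  then have "seq_compact (cball (0::complex) R - ball 0 \<epsilon>)" by (rule compact_imp_seq_compact)
  then obtain c \<rho> where c: "c \<in> cball 0 R - ball 0 \<epsilon>" and \<rho>: "strict_mono \<rho>"
    and lim: "((\<lambda>j. X (t j)) \<circ> \<rho>) \<longlonglongrightarrow> c"
    using t(2) seq_compactE by metis
  define \<tau> where "\<tau> = t \<circ> \<rho>"
  have lim: "(\<lambda>j. X (\<tau> j)) \<longlonglongrightarrow> c" using lim by (simp add: \<tau>_def o_def)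
  have \<tau>_ge: "\<tau> j \<ge> j" for j
    using t(1)[of "\<rho> j"] seq_suble[OF \<rho>, of j] by (simp add: \<tau>_def)
  then have \<tau>: "filterlim \<tau> at_top sequentially"
    by (intro filterlim_at_top_mono[OF filterlim_ident]) auto
  have c0: "c \<noteq> 0" using c \<epsilon> by auto
  have c1: "c \<noteq> -1"
  proof -
    have "(\<lambda>j. cmod (X (\<tau> j) + 1)) \<longlonglongrightarrow> cmod (c + 1)" by (intro tendsto_intros lim)
    moreover have "\<forall>\<^sub>F j in sequentially. 1 / 10 \<le> cmod (X (\<tau> j) + 1)"
      using eventually_ge_at_top[of N] by eventually_elim (use \<tau>_ge far_pole order_trans in blast)
    ultimately have "1 / 10 \<le> cmod (c + 1)" by (rule tendsto_lowerbound) simp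
    then show ?thesis by auto
  qed
  \<comment> \<open>Applied to \<open>c\<close> and to \<open>f c\<close>: as limits of orbit points
    both stay outside the open basin, hence off the positive axis.\<close>
  have notA_lim: "l \<notin> A" if "(\<lambda>j. X (\<sigma> j)) \<longlonglongrightarrow> l" for \<sigma> l
  proof
    assume "l \<in> A"
    then have "\<forall>\<^sub>F j in sequentially. X (\<sigma> j) \<in> A" using topological_tendstoD[OF that open_basin] by blast
    then show False using XA by simp
  qed
  have nonpos: "l \<notin> \<real>\<^sub>\<ge>\<^sub>0" if "l \<notin> A" "l \<noteq> 0" for l
    using pos_real_in_basin[of "Re l"] that
    by (metis complex_is_Real_iff complex_nonneg_Reals_iff less_eq_real_def of_real_0 of_real_Re)
  have cslit: "c \<notin> \<real>\<^sub>\<ge>\<^sub>0" using nonpos[OF notA_lim[OF lim] c0] .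
  have contf: "isCont f c" using has_field_derivative_zeta[OF c1] by (rule DERIV_isCont)
  have "(\<lambda>j. X (Suc (\<tau> j))) \<longlonglongrightarrow> f c"
    unfolding X_Suc by (rule isCont_tendsto_compose[OF contf lim])
  from nonpos[OF notA_lim[OF this]] have fcslit: "f c \<notin> \<real>\<^sub>\<ge>\<^sub>0"
    using c0 c1 lam by (simp add: zeta_eq_0_iff)
  have "isCont expansion c"
  proof -
    have "isCont (\<lambda>w. half_sine (f w)) c"
      by (rule isCont_o2[OF contf isCont_half_sine]) (use fcslit in auto)
    moreover have "isCont zeta_elast c"
      unfolding zeta_elast_def using c1 by (intro continuous_intros) (simp add: add_eq_0_iff2)
    ultimately show ?thesis
      unfolding expansion_def[abs_def] using isCont_half_sine[OF c0] half_sine_pos[OF fcslit]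
      by (intro continuous_intros) auto
  qed
  then have "(\<lambda>j. expansion (X (\<tau> j))) \<longlonglongrightarrow> expansion c" by (rule isCont_tendsto_compose[OF _ lim])
  moreover have "(\<lambda>j. expansion (X (\<tau> j))) \<longlonglongrightarrow> 1" by (rule filterlim_compose[OF E_lim \<tau>])
  ultimately have "expansion c = 1" by (rule LIMSEQ_unique)
  then show False using expansion_gt_1[OF cslit c1 fcslit] by simp
qed

text \<open>Basin points accumulate at \<open>z\<close>, and there the limit function takes the
  value \<open>a\<close>. Uniform closeness carries over to \<open>z\<close> itself, putting one of
  its iterates into the basin.\<close>

lemma fatou_in_basin:
  assumes "v \<in> fatou_set lam"
  shows "v \<in> Some ` A"
proof -
  define F where "F = (\<lambda>n w. the (zeta_iter lam n w))"
  obtain \<epsilon> where \<epsilon>: "\<epsilon> > 0" and def: "\<And>n w. w \<in> sball v \<epsilon> \<Longrightarrow> zeta_iter lam n w \<noteq> None"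
    and normal: "normal_family_on F (sball v \<epsilon>)"
    using assms unfolding fatou_set_def F_def by blast
  have self: "p \<in> sball p e" if "e > 0" for p e
    using that by (cases p) (auto simp: sball_def)
  have "v \<noteq> None"
  proof
    assume "v = None"
    \<comment> \<open>Infinity is never a Fatou point, because already the first iterate is
      undefined there.\<close>
    then show False using def[OF self[OF \<epsilon>], of "Suc 0"] by simp
  qed
  then obtain z where z: "v = Some z" by blast
  have in_sball: "Some u \<in> sball v \<epsilon>" if "u \<in> ball z (\<epsilon> / 2)" for u
    using ball_subset_sball[of z \<epsilon>] that by (auto simp: z)
  have avoid: "(f ^^ n) u \<noteq> -1" if "u \<in> ball z (\<epsilon> / 2)" for u n
    using def[OF in_sball[OF that]] by (rule orbit_avoids_pole)
  have F_eq: "F n (Some u) = Some ((f ^^ n) u)" if "u \<in> ball z (\<epsilon> / 2)" for u n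
    using zeta_iter_eq_funpow[of n lam u] avoid[OF that] by (simp add: F_def)
  have near: "\<exists>u\<in>A. dist u z < d" if "d > 0" for d
  proof (rule ccontr)
    assume "\<not> (\<exists>u\<in>A. dist u z < d)"
    then have "ball z (min d (\<epsilon> / 2)) \<inter> A = {}" by (auto simp: dist_commute)
    then show False using avoid that \<epsilon> by (intro no_basin_free_disc[of "min d (\<epsilon> / 2)" z]) auto
  qed
  obtain r g \<delta> where \<delta>: "strict_mono r" "\<delta> > 0"
    and unif: "\<And>e. e > 0 \<Longrightarrow> \<forall>\<^sub>F j in sequentially. \<forall>u\<in>sball v \<delta>. chordal (F (r j) u) (g u) < e"
  proof -
    obtain r g where r: "strict_mono r" and loc: "\<forall>w\<in>sball v \<epsilon>. \<exists>\<delta>>0. sball w \<delta> \<subseteq> sball v \<epsilon> \<and>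
        (\<forall>e>0. \<forall>\<^sub>F j in sequentially. \<forall>u\<in>sball w \<delta>. chordal (F (id (r j)) u) (g u) < e)"
      using normal unfolding normal_family_on_def by meson
    from bspec[OF loc self[OF \<epsilon>]] show thesis using that r by (auto simp del: chordal.simps)
  qed
  define d where "d = min (\<epsilon> / 2) (\<delta> / 2)"
  have d: "d > 0" using \<epsilon> \<delta> by (simp add: d_def)
  have in_\<delta>: "Some u \<in> sball v \<delta>" if "u \<in> ball z d" for u
    using ball_subset_sball[of z \<delta>] that by (auto simp: z d_def)
  have g_eq: "g (Some u) = Some (of_real a)" if u: "u \<in> A" "u \<in> ball z d" for u
  proof (rule chordal_limit_unique)
    have "(\<lambda>n. (f ^^ n) u) \<longlonglongrightarrow> of_real a" using u a_nz by (simp add: basin_iff)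
    from LIMSEQ_subseq_LIMSEQ[OF this \<delta>(1)] show "(\<lambda>j. (f ^^ (r j)) u) \<longlonglongrightarrow> of_real a"
      by (simp add: o_def)
    have nonneg: "chordal p q \<ge> 0" for p q by (cases p; cases q) auto
    show "(\<lambda>j. chordal (Some ((f ^^ (r j)) u)) (g (Some u))) \<longlonglongrightarrow> 0"
    proof (rule tendstoI)
      fix e :: real assume "e > 0"
      from unif[OF this] show "\<forall>\<^sub>F j in sequentially. dist (chordal (Some ((f ^^ r j) u)) (g (Some u))) 0 < e"
      proof eventually_elim
        case (elim j)
        then have "chordal (F (r j) (Some u)) (g (Some u)) < e" using in_\<delta>[OF u(2)] by blast
        moreover have "F (r j) (Some u) = Some ((f ^^ r j) u)" using u(2) by (intro F_eq) (simp add: d_def)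
        ultimately show ?case using nonneg by simp
      qed
    qed
  qed
  have "of_real a \<in> A" using pos_real_in_basin[OF a_pos] .
  then obtain \<eta> where \<eta>: "\<eta> > 0" "ball (of_real a) \<eta> \<subseteq> A" using open_basin openE by blast
  obtain e where e: "e > 0" "sball (Some (of_real a)) e \<subseteq> Some ` ball (of_real a) \<eta>"
    using sball_subset_ball[OF \<eta>(1)] by blast
  \<comment> \<open>One index \<open>j\<close> serves the whole disc. Only the continuity of the
    single map \<open>f ^^ r j\<close> at \<open>z\<close> is then needed, not that of
    \<open>g\<close>.\<close>
  obtain j where j: "\<And>u. u \<in> sball v \<delta> \<Longrightarrow> chordal (F (r j) u) (g u) < e / 2"
    using eventually_happens[OF unif[of "e / 2"]] e(1) by auto
  have "\<forall>k. \<exists>u. u \<in> A \<and> dist u z < min d (inverse (real (Suc k)))"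
    using near d by (metis inverse_positive_iff_positive min_less_iff_conj of_nat_0_less_iff zero_less_Suc)
  then obtain u where u: "\<And>k. u k \<in> A" "\<And>k. dist (u k) z < min d (inverse (real (Suc k)))" by metis
  have "(\<lambda>k. dist (u k) z) \<longlonglongrightarrow> 0"
  proof (rule Lim_null_comparison[OF always_eventually LIMSEQ_inverse_real_of_nat], rule allI)
    show "norm (dist (u k) z) \<le> inverse (real (Suc k))" for k using u(2)[of k] by (simp del: of_nat_Suc)
  qed
  then have u_lim: "u \<longlonglongrightarrow> z" by (subst tendsto_dist_iff)
  have "isCont (f ^^ r j) z" using avoid \<epsilon> by (intro isCont_funpow_zeta) auto
  then have "(\<lambda>k. (f ^^ r j) (u k)) \<longlonglongrightarrow> (f ^^ r j) z" by (rule isCont_tendsto_compose[OF _ u_lim])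
  then have "(\<lambda>k. chordal (Some ((f ^^ r j) (u k))) (Some (of_real a))) \<longlonglongrightarrow> chordal (Some ((f ^^ r j) z)) (Some (of_real a))"
    by (rule tendsto_chordal)
  moreover have "chordal (Some ((f ^^ r j) (u k))) (Some (of_real a)) \<le> e / 2" for k
  proof -
    have uk: "u k \<in> ball z d" using u(2)[of k] by (simp add: dist_commute)
    have "F (r j) (Some (u k)) = Some ((f ^^ r j) (u k))" using uk by (intro F_eq) (simp add: d_def)
    then show ?thesis using j[OF in_\<delta>[OF uk]] g_eq[OF u(1) uk] by simp
  qed
  ultimately have "chordal (Some ((f ^^ r j) z)) (Some (of_real a)) \<le> e / 2"
    by (intro LIMSEQ_le_const2) auto
  then have "Some ((f ^^ r j) z) \<in> sball (Some (of_real a)) e"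
    using e(1) by (simp add: sball_def norm_minus_commute mult.commute)
  then have "(f ^^ r j) z \<in> A" using e(2) \<eta>(2) by blast
  then have "z \<in> A" using a_nz funpow_zeta_in_basin_iff[where a = "of_real a" and n = "r j" and z = z] by simp
  then show ?thesis by (simp add: z)
qed

end

theorem theorem6:
  fixes lam a :: real
  assumes "1 < lam" and "lam < (sqrt 2 + 1) * exp (sqrt 2)"
    and "a \<noteq> 0" and "zeta lam (complex_of_real a) = complex_of_real a"
  shows "julia_set lam = UNIV - Some ` basin lam (complex_of_real a)"
proof -
  interpret attracting_zeta lam a using assms by unfold_locales
  have "fatou_set lam = Some ` basin lam (complex_of_real a)"
    using basin_in_fatou fatou_in_basin by auto
  then show ?thesis by (simp add: julia_set_def)
qed

end
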